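(* Let $\alpha\in(0,2)$, $\sigma>0$, $\nu\ge 0$, and let $L=(L(t))_{t\ge0}$ be a Lévy process with $\mathbf{E}e^{i\lambda L(t)}=e^{-t\sigma^\alpha|\lambda|^\alpha}$ for $\lambda\in\mathbb{R}$, $t\ge0$. For $n\ge1$ and $s<0$ let $$a_n^\nu(0;s):=\int_s^0 H_n^\nu(-r)\,dL_s(r),\qquad H_n^\nu(r):=n\,\frac{J_n(2r)}{r}\,e^{-\nu r},\qquad L_s(r):=L(r-s).$$ Say that the stationary probability distribution of the $n$-th component exists if $a_n^\nu(0;s)$ converges in distribution, as $s\to-\infty$, to a (real-valued) random variable $a_n^\nu$. Then: (i) if $\nu>0$, the stationary probability distribution exists for all $n\ge1$ and all $\alpha\in(0,2)$; (ii) if $\nu=0$, then for every $n\ge1$ the stationary probability distribution exists if and only if $\alpha\in(\tfrac23,2)$. Whenever it exists, it is $\alpha$-stable with characteristic function $$\mathbf{E}e^{i\lambda a_n^\nu}=\exp\Big(-|\lambda|^\alpha\sigma^\alpha n^\alpha\int_0^\infty\frac{|J_n(2r)|^\alpha}{r^\alpha}e^{-\alpha\nu r}\,dr\Big),\qquad \lambda\in\mathbb{R}.$$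
   Context: A Lévy process is a stochastically continuous real-valued process with stationary independent increments, started at $0$, with right-continuous paths having left limits. $J_n$ denotes the Bessel function of the first kind of order $n$, and $H_n^\nu$ is extended to $r=0$ by continuity. The integral $\int_s^0 H_n^\nu(-r)\,dL_s(r)$ is the usual stochastic integral of a smooth deterministic function against a Lévy process. The variable $a_n^\nu(0;s)$ is the value at time $0$ of the $n$-th component of the solution, started from zero initial values at time $s$, of the system $da_1=(-a_2-\nu a_1)\,dt+dL_s$, $da_n=(a_{n-1}-a_{n+1}-\nu a_n)\,dt$ for $n\ge 2$. *)

theory Defs
  imports "HOL-Probability.Probability"
begin

text \<open>Only the times \<open>t \<ge> 0\<close> matter; the values \<open>L t\<close> for \<open>t < 0\<close> are unconstrained. The
  requirements on the starting point and on the paths are imposed almost surely.\<close>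

locale levy_process = prob_space +
  fixes L :: "real \<Rightarrow> 'a \<Rightarrow> real"
  assumes random_variable_at: "\<And>t. 0 \<le> t \<Longrightarrow> L t \<in> borel_measurable M"
    and starts_at_zero: "AE \<omega> in M. L 0 \<omega> = 0"
    and stationary_increments: "\<And>s h. 0 \<le> s \<Longrightarrow> 0 \<le> h \<Longrightarrow>
      distr M borel (\<lambda>\<omega>. L (s + h) \<omega> - L s \<omega>) = distr M borel (\<lambda>\<omega>. L h \<omega> - L 0 \<omega>)"
    and independent_increments: "\<And>(N::nat) t. 0 \<le> t 0 \<Longrightarrow> (\<And>i. i < N \<Longrightarrow> t i \<le> t (Suc i)) \<Longrightarrow>
      indep_vars (\<lambda>_. borel) (\<lambda>i \<omega>. L (t (Suc i)) \<omega> - L (t i) \<omega>) {..<N}"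
    and stochastically_continuous: "\<And>t e. 0 \<le> t \<Longrightarrow> 0 < e \<Longrightarrow>
      ((\<lambda>s. prob {\<omega> \<in> space M. \<bar>L s \<omega> - L t \<omega>\<bar> > e}) \<longlongrightarrow> 0) (at t within {0..})"
    and cadlag_paths: "AE \<omega> in M.
      (\<forall>t\<ge>0. continuous (at_right t) (\<lambda>s. L s \<omega>)) \<and>
      (\<forall>t>0. \<exists>l. ((\<lambda>s. L s \<omega>) \<longlongrightarrow> l) (at_left t))"

text \<open>The random variable \<open>I\<close> is the integral of \<open>f\<close> over \<open>[a, b]\<close> against the process \<open>X\<close> if
  it is the limit in probability of the left-endpoint Riemann sums as the mesh of the partition
  \<open>a = t 0 \<le> \<dots> \<le> t N = b\<close> tends to zero. For a continuous \<open>f\<close> and a semimartingale \<open>X\<close>, in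
  particular for a (shifted) Levy process, this limit exists and is the usual Ito integral.\<close>

definition has_stochastic_integral ::
  "'a measure \<Rightarrow> (real \<Rightarrow> 'a \<Rightarrow> real) \<Rightarrow> (real \<Rightarrow> real) \<Rightarrow> real \<Rightarrow> real \<Rightarrow> ('a \<Rightarrow> real) \<Rightarrow> bool"
  where
  "has_stochastic_integral M X f a b I \<longleftrightarrow>
     I \<in> borel_measurable M \<and>
     (\<forall>e>0. \<exists>d>0. \<forall>(N::nat) t.
        t 0 = a \<and> t N = b \<and> (\<forall>i<N. t i \<le> t (Suc i) \<and> t (Suc i) - t i < d) \<longrightarrow>
        measure M {\<omega> \<in> space M.
          \<bar>(\<Sum>i<N. f (t i) * (X (t (Suc i)) \<omega> - X (t i) \<omega>)) - I \<omega>\<bar> > e} < e)"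

text \<open>Such an \<open>I\<close> is determined up to a null set, so the choice of the version below does not
  affect distributions.\<close>

definition stochastic_integral ::
  "'a measure \<Rightarrow> (real \<Rightarrow> 'a \<Rightarrow> real) \<Rightarrow> (real \<Rightarrow> real) \<Rightarrow> real \<Rightarrow> real \<Rightarrow> 'a \<Rightarrow> real"
  where
  "stochastic_integral M X f a b = (SOME I. has_stochastic_integral M X f a b I)"

definition bessel_J :: "nat \<Rightarrow> real \<Rightarrow> real" where
  "bessel_J n x = (\<Sum>k. (-1) ^ k / (fact k * fact (n + k)) * (x / 2) ^ (2 * k + n))"

definition H :: "nat \<Rightarrow> real \<Rightarrow> real \<Rightarrow> real" where
  "H n \<nu> r =
     (let h = (\<lambda>x. real n * (bessel_J n (2 * x) / x) * exp (- \<nu> * x))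
      in if r = 0 then Lim (at 0) h else h r)"

definition component ::
  "'a measure \<Rightarrow> (real \<Rightarrow> 'a \<Rightarrow> real) \<Rightarrow> nat \<Rightarrow> real \<Rightarrow> real \<Rightarrow> 'a \<Rightarrow> real" where
  "component M L n \<nu> s = stochastic_integral M (\<lambda>r. L (r - s)) (\<lambda>r. H n \<nu> (- r)) s 0"

text \<open>The analogue of \<^const>\<open>weak_conv_m\<close> along an arbitrary filter. The limit law \<open>\<mu>\<close> is
  required to be a probability measure on the real line.\<close>

definition converges_in_distribution ::
  "'a measure \<Rightarrow> ('i \<Rightarrow> 'a \<Rightarrow> real) \<Rightarrow> real measure \<Rightarrow> 'i filter \<Rightarrow> bool" where
  "converges_in_distribution M X \<mu> F \<longleftrightarrow>
     real_distribution \<mu> \<and>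
     (\<forall>x. isCont (cdf \<mu>) x \<longrightarrow> ((\<lambda>i. cdf (distr M borel (X i)) x) \<longlongrightarrow> cdf \<mu> x) F)"

definition is_stationary_distribution ::
  "'a measure \<Rightarrow> (real \<Rightarrow> 'a \<Rightarrow> real) \<Rightarrow> nat \<Rightarrow> real \<Rightarrow> real measure \<Rightarrow> bool" where
  "is_stationary_distribution M L n \<nu> \<mu> \<longleftrightarrow>
     converges_in_distribution M (component M L n \<nu>) \<mu> at_bot"

definition stationary_distribution_exists ::
  "'a measure \<Rightarrow> (real \<Rightarrow> 'a \<Rightarrow> real) \<Rightarrow> nat \<Rightarrow> real \<Rightarrow> bool" where
  "stationary_distribution_exists M L n \<nu> \<longleftrightarrow> (\<exists>\<mu>. is_stationary_distribution M L n \<nu> \<mu>)"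

text \<open>A nondegenerate law is \<open>\<alpha>\<close>-stable if, for independent \<open>Y\<close>, \<open>Z\<close> with this law and all
  \<open>A, B > 0\<close>, the variable \<open>A Y + B Z\<close> is distributed as \<open>C Y + D\<close> for some real \<open>D\<close>, where
  \<open>C\<close> is given by \<open>C\<^sup>\<alpha> = A\<^sup>\<alpha> + B\<^sup>\<alpha>\<close>.\<close>

definition stable_distribution :: "real \<Rightarrow> real measure \<Rightarrow> bool" where
  "stable_distribution \<alpha> \<mu> \<longleftrightarrow>
     0 < \<alpha> \<and> \<alpha> \<le> 2 \<and> real_distribution \<mu> \<and> (\<forall>c. measure \<mu> {c} < 1) \<and>
     (\<forall>A>0. \<forall>B>0. \<exists>D.
        convolution (distr \<mu> borel (\<lambda>x. A * x)) (distr \<mu> borel (\<lambda>x. B * x)) =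
        distr \<mu> borel (\<lambda>x. (A powr \<alpha> + B powr \<alpha>) powr (1 / \<alpha>) * x + D))"

end

theory Submission
  imports Defs "HOL-Real_Asymp.Real_Asymp"
begin

text \<open>Differences of Riemann sums of a continuous function against \<open>L\<close> are, after passing to a common
  refinement, sums of independent scaled copies of \<open>L 1\<close>, hence themselves scaled copies of \<open>L 1\<close> with
  small scale. So the Riemann sums converge in probability, and the integral over \<open>[s, 0]\<close> has
  characteristic function \<open>exp (- \<bar>u\<bar>\<^sup>\<alpha> \<sigma>\<^sup>\<alpha> A s)\<close> with \<open>A s = \<integral>\<^sub>0\<^sup>-\<^sup>s \<bar>H\<bar>\<^sup>\<alpha>\<close>. By Levy's continuity theorem a
  limit law exists iff \<open>A\<close> is bounded, that is, iff \<open>\<bar>H\<bar>\<^sup>\<alpha>\<close> is integrable.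

  For \<open>\<nu> = 0\<close> this depends on the decay of \<open>J\<^sub>n\<close>. The energy of \<open>w = sqrt x J\<^sub>n\<close> stays between two positive
  constants, so \<open>\<bar>J\<^sub>n x\<bar> = O(x powr (-1/2))\<close>, which gives integrability for \<open>\<alpha> > 2/3\<close>. As \<open>w\<close> and \<open>w'\<close> have
  equal mean squares up to bounded terms, \<open>\<integral> J\<^sub>n\<^sup>2\<close> diverges logarithmically; and \<open>\<bar>H\<bar>\<^sup>\<alpha>\<close> dominates \<open>J\<^sub>n\<^sup>2\<close> up to
  a constant when \<open>\<alpha> \<le> 2/3\<close>.\<close>

section \<open>Bessel functions\<close>

definition bessel_coeff :: "nat \<Rightarrow> nat \<Rightarrow> real" where
  "bessel_coeff n k = (-1) ^ k / (fact k * fact (n + k))"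

text \<open>The cofactor of \<open>(x / 2) ^ n\<close> in \<open>bessel_J n x\<close>, as a power
  series in \<open>z = x\<^sup>2 / 4\<close>. Being entire, it allows termwise differentiation and
  removes the singularity of \<open>H\<close> at 0.\<close>

definition bessel_entire :: "nat \<Rightarrow> real \<Rightarrow> real" where
  "bessel_entire n z = (\<Sum>k. bessel_coeff n k * z ^ k)"

lemma summable_bessel_coeff: "summable (\<lambda>k. bessel_coeff n k * z ^ k)"
proof (rule summable_comparison_test)
  show "\<exists>N. \<forall>k\<ge>N. norm (bessel_coeff n k * z ^ k) \<le> inverse (fact k) * \<bar>z\<bar> ^ k"
  proof (intro exI[of _ 0] allI impI)
    fix k
    have "(1::real) \<le> fact (n + k)" by (rule fact_ge_1)
    then have "1 / (fact k * fact (n + k)) \<le> (1::real) / fact k"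
      by (simp add: divide_simps)
    then show "norm (bessel_coeff n k * z ^ k) \<le> inverse (fact k) * \<bar>z\<bar> ^ k"
      using mult_right_mono[of "1 / (fact k * fact (n + k))" "1 / fact k :: real" "\<bar>z\<bar> ^ k"]
      by (simp add: bessel_coeff_def abs_mult power_abs inverse_eq_divide)
  qed
  show "summable (\<lambda>k. inverse (fact k) * \<bar>z\<bar> ^ k)" by (rule summable_exp)
qed

lemma diffs_bessel_coeff: "diffs (bessel_coeff n) k = - bessel_coeff (Suc n) k"
  by (simp add: diffs_def bessel_coeff_def divide_simps)

lemma DERIV_bessel_entire: "(bessel_entire n has_field_derivative - bessel_entire (Suc n) z) (at z)"
proof -
  have "((\<lambda>z. \<Sum>k. bessel_coeff n k * z ^ k) has_field_derivative
      (\<Sum>k. diffs (bessel_coeff n) k * z ^ k)) (at z)"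
    by (rule termdiffs_strong_converges_everywhere) (rule summable_bessel_coeff)
  moreover have "(\<Sum>k. diffs (bessel_coeff n) k * z ^ k) = - bessel_entire (Suc n) z"
    using suminf_minus[OF summable_bessel_coeff[of "Suc n" z]]
    by (simp add: diffs_bessel_coeff bessel_entire_def)
  ultimately show ?thesis
    by (simp add: bessel_entire_def[abs_def])
qed

lemma isCont_bessel_entire: "isCont (bessel_entire n) z"
  using DERIV_isCont DERIV_bessel_entire by blast

lemma continuous_on_bessel_entire [continuous_intros]:
  "continuous_on S f \<Longrightarrow> continuous_on S (\<lambda>x. bessel_entire n (f x))"
  by (rule continuous_on_compose2[of UNIV "bessel_entire n"])
     (auto simp: continuous_on_eq_continuous_at isCont_bessel_entire)

text \<open>The three-term recurrence of the Bessel functions, stripped of powers of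
  \<open>x\<close>. It holds coefficient by coefficient: the constant terms cancel, and the
  remaining ones reduce to an identity between factorials.\<close>

lemma bessel_entire_recurrence:
  "bessel_entire n z - (real n + 1) * bessel_entire (Suc n) z + z * bessel_entire (n + 2) z = 0"
proof -
  have "(\<lambda>k. bessel_coeff n k * z ^ k - (real n + 1) * (bessel_coeff (Suc n) k * z ^ k))
      sums (bessel_entire n z - (real n + 1) * bessel_entire (Suc n) z)"
    unfolding bessel_entire_def
    by (intro sums_diff sums_mult summable_sums summable_bessel_coeff)
  moreover have "(\<lambda>k. bessel_coeff n k * z ^ k - (real n + 1) * (bessel_coeff (Suc n) k * z ^ k))
      sums (- z * bessel_entire (n + 2) z)"
  proof -
    have "(\<lambda>k. - z * (bessel_coeff (n + 2) k * z ^ k)) sums (- z * bessel_entire (n + 2) z)"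
      unfolding bessel_entire_def
      by (intro sums_mult summable_sums summable_bessel_coeff)
    \<comment> \<open>The factor \<open>z\<close> shifts the index: term \<open>k\<close> here is
      term \<open>Suc k\<close> of the series above, whose term 0 vanishes.\<close>
    moreover have "- z * (bessel_coeff (n + 2) k * z ^ k) =
        bessel_coeff n (Suc k) * z ^ Suc k - (real n + 1) * (bessel_coeff (Suc n) (Suc k) * z ^ Suc k)" for k
    proof -
      have "bessel_coeff n (Suc k) - (real n + 1) * bessel_coeff (Suc n) (Suc k) = - bessel_coeff (n + 2) k"
        by (simp add: bessel_coeff_def divide_simps) (simp add: algebra_simps)
      then have "- bessel_coeff (n + 2) k * (z * z ^ k) =
          (bessel_coeff n (Suc k) - (real n + 1) * bessel_coeff (Suc n) (Suc k)) * (z * z ^ k)"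
        by simp
      then show ?thesis
        by (simp add: algebra_simps)
    qed
    ultimately have "(\<lambda>k. bessel_coeff n (Suc k) * z ^ Suc k
          - (real n + 1) * (bessel_coeff (Suc n) (Suc k) * z ^ Suc k))
        sums (- z * bessel_entire (n + 2) z)"
      by simp
    moreover have "bessel_coeff n 0 * z ^ 0 - (real n + 1) * (bessel_coeff (Suc n) 0 * z ^ 0) = 0"
      by (simp add: bessel_coeff_def add.commute)
    ultimately show ?thesis
      using sums_Suc_iff[of "\<lambda>k. bessel_coeff n k * z ^ k - (real n + 1) * (bessel_coeff (Suc n) k * z ^ k)"
        "- z * bessel_entire (n + 2) z"] by simp
  qed
  ultimately show ?thesis
    using sums_unique2 by fastforce
qed

lemma bessel_J_eq_entire: "bessel_J n x = (x / 2) ^ n * bessel_entire n (x\<^sup>2 / 4)"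
proof -
  have "bessel_J n x = (\<Sum>k. (x / 2) ^ n * (bessel_coeff n k * (x\<^sup>2 / 4) ^ k))"
    unfolding bessel_J_def
    by (rule arg_cong[where f = suminf])
       (simp add: bessel_coeff_def power_add power_mult power_divide fun_eq_iff; simp add: mult_ac)
  then show ?thesis
    by (simp add: bessel_entire_def suminf_mult summable_bessel_coeff)
qed

lemma DERIV_bessel_J:
  assumes "x \<noteq> 0"
  shows "(bessel_J n has_field_derivative n / x * bessel_J n x - bessel_J (Suc n) x) (at x)"
proof -
  have *: "((\<lambda>x. bessel_entire n (x\<^sup>2 / 4)) has_field_derivative
      - bessel_entire (Suc n) (x\<^sup>2 / 4) * (x / 2)) (at x)"
    by (rule DERIV_chain2[OF DERIV_bessel_entire]) (auto intro!: derivative_eq_intros)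
  have "((\<lambda>x. (x / 2) ^ n * bessel_entire n (x\<^sup>2 / 4)) has_field_derivative
      n / x * bessel_J n x - bessel_J (Suc n) x) (at x)"
    by (rule DERIV_cong[OF DERIV_mult[OF DERIV_power[OF DERIV_cdivide[OF DERIV_ident]] *]])
       (use assms in \<open>cases n; simp add: bessel_J_eq_entire field_simps\<close>)
  then show ?thesis
    by (simp add: bessel_J_eq_entire[abs_def])
qed

lemma bessel_J_recurrence:
  assumes "x \<noteq> 0"
  shows "bessel_J (n + 2) x = 2 * (real n + 1) / x * bessel_J (Suc n) x - bessel_J n x"
proof -
  have "bessel_entire n (x\<^sup>2 / 4) =
      (real n + 1) * bessel_entire (Suc n) (x\<^sup>2 / 4) - x\<^sup>2 / 4 * bessel_entire (n + 2) (x\<^sup>2 / 4)"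
    using bessel_entire_recurrence[of n "x\<^sup>2 / 4"] by simp
  then have "bessel_J (n + 2) x = (x / 2) ^ n * ((real n + 1) * bessel_entire (Suc n) (x\<^sup>2 / 4)
      - bessel_entire n (x\<^sup>2 / 4))"
    by (simp add: bessel_J_eq_entire power_add power2_eq_square)
  also have "\<dots> = 2 * (real n + 1) / x * bessel_J (Suc n) x - bessel_J n x"
    using assms by (simp add: bessel_J_eq_entire right_diff_distrib)
  finally show ?thesis .
qed

text \<open>The recurrence eliminates the index \<open>n + 2\<close>, so that
  \<open>bessel_J n\<close> and \<open>bessel_J (Suc n)\<close> form a closed first-order
  system.\<close>

lemma DERIV_bessel_J_Suc:
  assumes "x \<noteq> 0"
  shows "(bessel_J (Suc n) has_field_derivative
    bessel_J n x - (real n + 1) / x * bessel_J (Suc n) x) (at x)"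
proof -
  have "bessel_J n x - (real n + 1) / x * bessel_J (Suc n) x =
      real (Suc n) / x * bessel_J (Suc n) x - bessel_J (Suc (Suc n)) x"
    using bessel_J_recurrence[OF assms, of n] by (simp add: add_divide_distrib algebra_simps)
  then show ?thesis
    using DERIV_bessel_J[OF assms, of "Suc n"] by metis
qed

text \<open>The entire factor is continuous and equals \<open>1 / fact n\<close> at 0. This serves
  twice: for a point of positive energy, and for the positivity of the integral in the exponent of
  the limit law.\<close>

lemma bessel_J_nonzero_near_0: "\<exists>x0>0. \<forall>x. 0 < x \<and> x < x0 \<longrightarrow> bessel_J n x \<noteq> 0"
proof -
  have "bessel_entire n 0 = bessel_coeff n 0"
    unfolding bessel_entire_def by (subst suminf_finite[of "{0}"]) auto
  then have "bessel_entire n 0 \<noteq> 0"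
    by (simp add: bessel_coeff_def)
  moreover have "isCont (\<lambda>x::real. bessel_entire n (x\<^sup>2 / 4)) 0"
    by (rule isCont_o2[where g = "bessel_entire n"]) (simp_all add: isCont_bessel_entire)
  then have "((\<lambda>x::real. bessel_entire n (x\<^sup>2 / 4)) \<longlongrightarrow> bessel_entire n 0) (nhds 0)"
    using tendsto_at_iff_tendsto_nhds[of "\<lambda>x::real. bessel_entire n (x\<^sup>2 / 4)" 0]
    by (simp add: isCont_def)
  ultimately have "eventually (\<lambda>x::real. bessel_entire n (x\<^sup>2 / 4) \<noteq> 0) (nhds 0)"
    by (intro tendsto_imp_eventually_ne)
  then obtain d where "d > 0" "\<And>x::real. \<bar>x\<bar> < d \<Longrightarrow> bessel_entire n (x\<^sup>2 / 4) \<noteq> 0"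
    by (auto simp: eventually_nhds_metric dist_real_def)
  then show ?thesis
    by (intro exI[of _ d]) (auto simp: bessel_J_eq_entire)
qed


section \<open>Size of the Bessel functions at infinity: the energy method\<close>

text \<open>For \<open>w x = sqrt x * bessel_J n x\<close>, Bessel's equation becomes
  \<open>w'' = - (1 - (n\<^sup>2 - 1/4) / x\<^sup>2) w\<close>. Here \<open>w' = sqrt x * bessel_V n x\<close> and the energy below is
  \<open>w\<^sup>2 + w'\<^sup>2\<close>.\<close>

definition bessel_V :: "nat \<Rightarrow> real \<Rightarrow> real" where
  "bessel_V n x = (real n + 1 / 2) / x * bessel_J n x - bessel_J (Suc n) x"

definition bessel_energy :: "nat \<Rightarrow> real \<Rightarrow> real" where
  "bessel_energy n x = x * ((bessel_J n x)\<^sup>2 + (bessel_V n x)\<^sup>2)"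

lemma DERIV_bessel_J_V:
  assumes "x > 0"
  shows "(bessel_J n has_field_derivative bessel_V n x - bessel_J n x / (2 * x)) (at x)"
  using DERIV_bessel_J[of x n] assms
  by (simp add: bessel_V_def add_divide_distrib algebra_simps)

lemma DERIV_bessel_V:
  assumes "x > 0"
  shows "(bessel_V n has_field_derivative
    - bessel_V n x / (2 * x) - bessel_J n x + ((real n)\<^sup>2 - 1 / 4) * bessel_J n x / x\<^sup>2) (at x)"
proof -
  note D = DERIV_bessel_J[of x n] DERIV_bessel_J_Suc[of x n]
  show ?thesis
    unfolding bessel_V_def[abs_def]
    by (rule DERIV_cong[OF DERIV_diff[OF DERIV_mult[OF DERIV_divide[OF DERIV_const DERIV_ident] D(1)] D(2)]])
       (use assms in \<open>simp_all add: field_simps power2_eq_square\<close>)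
qed

text \<open>In terms of \<open>w\<close>, the derivative is \<open>2 w' (w + w'')\<close>. Bessel's
  equation cancels the leading terms and leaves only the perturbation of order
  \<open>1 / x\<^sup>2\<close>.\<close>

lemma DERIV_bessel_energy:
  assumes "x > 0"
  shows "(bessel_energy n has_field_derivative
    2 * ((real n)\<^sup>2 - 1 / 4) * (bessel_J n x * bessel_V n x) / x) (at x)"
proof -
  note D = DERIV_bessel_J_V[OF assms, of n] DERIV_bessel_V[OF assms, of n]
  show ?thesis
    unfolding bessel_energy_def[abs_def]
    by (rule DERIV_cong[OF DERIV_mult[OF DERIV_ident DERIV_add[OF DERIV_power[OF D(1)] DERIV_power[OF D(2)]]]])
       (use assms in \<open>simp add: field_simps power2_eq_square\<close>)
qed

lemma abs_bessel_J_mult_V_le: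
  assumes "x > 0"
  shows "\<bar>bessel_J n x * bessel_V n x\<bar> \<le> bessel_energy n x / (2 * x)"
proof -
  have "2 * \<bar>bessel_J n x * bessel_V n x\<bar> \<le> (bessel_J n x)\<^sup>2 + (bessel_V n x)\<^sup>2"
    using sum_squares_bound[of "\<bar>bessel_J n x\<bar>" "\<bar>bessel_V n x\<bar>"] by (simp add: abs_mult mult.assoc)
  then show ?thesis
    using assms by (simp add: bessel_energy_def)
qed

text \<open>The energy changes at a relative rate of at most \<open>C / x\<^sup>2\<close>, which is
  integrable at infinity; so it can neither decay to 0 nor blow up.\<close>

lemma bessel_energy_bounds:
  obtains x0 m K where "x0 > 0" "m > 0"
    "\<And>x. x \<ge> x0 \<Longrightarrow> m \<le> bessel_energy n x" "\<And>x. x \<ge> x0 \<Longrightarrow> bessel_energy n x \<le> K"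
proof -
  obtain x1 where x1: "x1 > 0" "\<And>x. 0 < x \<Longrightarrow> x < x1 \<Longrightarrow> bessel_J n x \<noteq> 0"
    using bessel_J_nonzero_near_0 by metis
  \<comment> \<open>A point where \<open>bessel_J n\<close> does not vanish: the energy there is
    positive, and hence so is the lower bound \<open>m\<close> derived from it.\<close>
  define x0 where "x0 = x1 / 2"
  define c where "c = (real n)\<^sup>2 - 1 / 4"
  define C where "C = \<bar>c\<bar>"
  have x0: "x0 > 0" "bessel_J n x0 \<noteq> 0"
    using x1 by (auto simp: x0_def)
  then have E0: "bessel_energy n x0 > 0"
    unfolding bessel_energy_def by (intro mult_pos_pos add_pos_nonneg) auto
  define D where "D x = 2 * c * (bessel_J n x * bessel_V n x) / x" for x
  have D_bound: "\<bar>D x\<bar> \<le> C / x\<^sup>2 * bessel_energy n x" if "x > 0" for x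
  proof -
    have "\<bar>D x\<bar> = 2 * C * \<bar>bessel_J n x * bessel_V n x\<bar> / x"
      using that by (simp add: D_def C_def abs_mult)
    also have "\<dots> \<le> 2 * C * (bessel_energy n x / (2 * x)) / x"
      using that by (intro divide_right_mono mult_left_mono abs_bessel_J_mult_V_le) (auto simp: C_def)
    also have "\<dots> = C / x\<^sup>2 * bessel_energy n x"
      using that by (simp add: power2_eq_square)
    finally show ?thesis .
  qed
  \<comment> \<open>Gronwall: since \<open>\<bar>E'\<bar> \<le> (C / x\<^sup>2) E\<close>, the functions \<open>E exp (- C / x)\<close> and \<open>E exp (C / x)\<close>
    are monotone in opposite directions.\<close>
  have DE: "((\<lambda>x. bessel_energy n x * exp (a / x)) has_field_derivative
      (D x - a / x\<^sup>2 * bessel_energy n x) * exp (a / x)) (at x)" if "x > 0" for x a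
    unfolding D_def c_def
    by (rule DERIV_cong[OF DERIV_mult[OF DERIV_bessel_energy[OF that]
          DERIV_chain2[OF DERIV_exp DERIV_divide[OF DERIV_const DERIV_ident]]]])
       (use that in \<open>simp_all add: field_simps power2_eq_square\<close>)
  have lower: "bessel_energy n x0 * exp (- C / x0) \<le> bessel_energy n x" if "x \<ge> x0" for x
  proof -
    have "bessel_energy n x0 * exp (- C / x0) \<le> bessel_energy n x * exp (- C / x)"
    proof (rule DERIV_nonneg_imp_nondecreasing[OF that])
      fix y assume "x0 \<le> y"
      with x0 have y: "y > 0" by simp
      show "\<exists>d. ((\<lambda>x. bessel_energy n x * exp (- C / x)) has_real_derivative d) (at y) \<and> 0 \<le> d"
        using DE[OF y, of "- C"] D_bound[OF y] by (intro exI conjI) auto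
    qed
    also have "\<dots> \<le> bessel_energy n x * 1"
      using that x0 by (intro mult_left_mono) (auto simp: C_def bessel_energy_def)
    finally show ?thesis by simp
  qed
  have upper: "bessel_energy n x \<le> bessel_energy n x0 * exp (C / x0)" if "x \<ge> x0" for x
  proof -
    have "bessel_energy n x * 1 \<le> bessel_energy n x * exp (C / x)"
      using that x0 by (intro mult_left_mono) (auto simp: C_def bessel_energy_def)
    also have "\<dots> \<le> bessel_energy n x0 * exp (C / x0)"
    proof (rule DERIV_nonpos_imp_nonincreasing[OF that])
      fix y assume "x0 \<le> y"
      with x0 have y: "y > 0" by simp
      show "\<exists>d. ((\<lambda>x. bessel_energy n x * exp (C / x)) has_real_derivative d) (at y) \<and> d \<le> 0"
        using DE[OF y, of "C"] D_bound[OF y] by (intro exI conjI) (auto intro!: mult_nonpos_nonneg)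
    qed
    finally show ?thesis by simp
  qed
  show ?thesis
    using that[OF x0(1) _ lower upper] E0 by simp
qed

lemma abs_bessel_J_le:
  obtains x0 K where "x0 > 0" "\<And>x. x \<ge> x0 \<Longrightarrow> \<bar>bessel_J n x\<bar> \<le> K * x powr (-1/2)"
proof -
  obtain x0 K where x0: "x0 > 0" and K: "\<And>x. x \<ge> x0 \<Longrightarrow> bessel_energy n x \<le> K"
    using bessel_energy_bounds[of n] by metis
  have "\<bar>bessel_J n x\<bar> \<le> sqrt K * x powr (-1/2)" if "x \<ge> x0" for x
  proof -
    have "x > 0" using that x0 by simp
    have "x * (bessel_J n x)\<^sup>2 \<le> bessel_energy n x"
      using \<open>x > 0\<close> by (simp add: bessel_energy_def)
    also have "\<dots> \<le> K" by (rule K[OF that])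
    finally have "(bessel_J n x)\<^sup>2 \<le> K / x"
      using \<open>x > 0\<close> by (simp add: field_simps)
    then have "\<bar>bessel_J n x\<bar> \<le> sqrt (K / x)"
      using real_le_rsqrt[of "\<bar>bessel_J n x\<bar>" "K / x"] by simp
    also have "\<dots> = sqrt K * x powr (-1/2)"
    proof -
      have "x powr (- 1 / 2) = inverse (sqrt x)"
        using \<open>x > 0\<close> powr_minus[of x "1 / 2"] powr_half_sqrt[of x] by simp
      then show ?thesis
        by (simp add: real_sqrt_divide inverse_eq_divide)
    qed
    finally show ?thesis .
  qed
  with x0 show ?thesis using that by blast
qed

lemma continuous_on_bessel_J: "continuous_on S (bessel_J n)"
  unfolding bessel_J_eq_entire[abs_def] by (intro continuous_intros) auto

lemma integral_bessel_J_squared_ge: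
  obtains x0 m C where "x0 > 0" "m > 0"
    "\<And>y. y \<ge> x0 \<Longrightarrow> m * ln y - C \<le> integral {x0..y} (\<lambda>x. (bessel_J n (2 * x))\<^sup>2)"
proof -
  obtain x0 m K where x0: "x0 > 0" and m: "m > 0" "\<And>x. x \<ge> x0 \<Longrightarrow> m \<le> bessel_energy n x"
    and K: "\<And>x. x \<ge> x0 \<Longrightarrow> bessel_energy n x \<le> K"
    using bessel_energy_bounds[of n] by metis
  define c where "c = (real n)\<^sup>2 - 1 / 4"
  \<comment> \<open>The two summands absorb the error terms \<open>J V / x\<close> and
    \<open>c J\<^sup>2 / x\<^sup>2\<close> of \<open>d\<close>, each of order
    \<open>1 / x\<^sup>2\<close> by the energy bound.\<close>
  define C where "C = (1 / 2 + \<bar>c\<bar> / x0) * K"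
  define J where "J = bessel_J n"
  define V where "V = bessel_V n"
  define d where "d x = V x ^ 2 - J x ^ 2 - J x * V x / x + c * (J x)\<^sup>2 / x\<^sup>2" for x
  have "K > 0"
    using m K[OF order_refl] m(2)[OF order_refl] by linarith
  have d: "((\<lambda>x. J x * V x) has_field_derivative d x) (at x)" if "x > 0" for x
    unfolding J_def V_def
    by (rule DERIV_cong[OF DERIV_mult[OF DERIV_bessel_J_V[OF that] DERIV_bessel_V[OF that]]])
       (use that in \<open>simp add: field_simps power2_eq_square d_def c_def J_def V_def\<close>)
  have JV: "\<bar>J x * V x\<bar> \<le> K / (2 * x)" if "x \<ge> x0" for x
  proof -
    have "\<bar>J x * V x\<bar> \<le> bessel_energy n x / (2 * x)"
      unfolding J_def V_def using that x0 by (intro abs_bessel_J_mult_V_le) simp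
    also have "\<dots> \<le> K / (2 * x)"
      using that x0 by (intro divide_right_mono K) auto
    finally show ?thesis .
  qed
  \<comment> \<open>Up to the derivative \<open>d\<close> of \<open>J V\<close> and an integrable error, \<open>2 J\<^sup>2\<close> is \<open>J\<^sup>2 + V\<^sup>2\<close>, which the
    energy bounds from below by \<open>m / x\<close>.\<close>
  have main: "m / x - C / x\<^sup>2 - d x \<le> 2 * (J x)\<^sup>2" if "x \<ge> x0" for x
  proof -
    have x: "x > 0" using x0 that by simp
    have E: "(J x)\<^sup>2 + (V x)\<^sup>2 = bessel_energy n x / x"
      using x by (simp add: bessel_energy_def J_def V_def)
    have "m / x \<le> (J x)\<^sup>2 + (V x)\<^sup>2"
      unfolding E using x that by (intro divide_right_mono m) auto
    moreover have "J x * V x / x \<le> (1/2 * K) / x\<^sup>2"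
      using JV[OF that] x by (simp add: field_simps power2_eq_square abs_le_iff)
    moreover have "- (c * (J x)\<^sup>2 / x\<^sup>2) \<le> \<bar>c\<bar> / x0 * K / x\<^sup>2"
    proof -
      have "(J x)\<^sup>2 \<le> (J x)\<^sup>2 + (V x)\<^sup>2" by simp
      also have "\<dots> \<le> K / x0"
        unfolding E using x x0 that K[OF that] \<open>K > 0\<close> by (intro frac_le) auto
      finally have "\<bar>c\<bar> * (J x)\<^sup>2 \<le> \<bar>c\<bar> * (K / x0)"
        by (intro mult_left_mono) auto
      moreover have "- c * (J x)\<^sup>2 \<le> \<bar>c\<bar> * (J x)\<^sup>2"
        by (intro mult_right_mono) auto
      ultimately have "- c * (J x)\<^sup>2 \<le> \<bar>c\<bar> / x0 * K" by simp
      then show ?thesis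
        using divide_right_mono[of "- c * (J x)\<^sup>2" "\<bar>c\<bar> / x0 * K" "x\<^sup>2"] by simp
    qed
    ultimately show ?thesis
      by (simp add: d_def C_def add_divide_distrib distrib_right) 
  qed
  \<comment> \<open>An antiderivative of the lower bound in \<open>main\<close>.\<close>
  define G where "G x = m * ln x + C / x - J x * V x" for x
  have DG: "(G has_field_derivative m / x - C / x\<^sup>2 - d x) (at x)" if x: "x > 0" for x
    unfolding G_def[abs_def]
    by (rule DERIV_cong[OF DERIV_diff[OF DERIV_add[OF DERIV_cmult[OF DERIV_ln[OF x]]
            DERIV_divide[OF DERIV_const DERIV_ident]] d[OF x]]])
       (use x in \<open>simp_all add: power2_eq_square divide_inverse\<close>)
  \<comment> \<open>The factor 4 is the 2 of \<open>main\<close> times the inner derivative of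
    \<open>G (2 * x)\<close>.\<close>
  have G: "G (2 * y) - G (2 * x0) \<le> 4 * integral {x0..y} (\<lambda>x. (J (2 * x))\<^sup>2)" if "y \<ge> x0" for y
  proof -
    have "((\<lambda>x. (m / (2 * x) - C / (2 * x)\<^sup>2 - d (2 * x)) * 2) has_integral (G (2 * y) - G (2 * x0))) {x0..y}"
    proof (rule fundamental_theorem_of_calculus[OF that])
      fix x assume "x \<in> {x0..y}"
      then have x: "2 * x > 0" using x0 by simp
      have "((\<lambda>x. G (2 * x)) has_field_derivative (m / (2 * x) - C / (2 * x)\<^sup>2 - d (2 * x)) * 2) (at x)"
        by (rule DERIV_chain2[of G _ "\<lambda>x. 2 * x", OF DG[OF x]]) (auto intro!: derivative_eq_intros)
      then show "((\<lambda>x. G (2 * x)) has_vector_derivative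
          (m / (2 * x) - C / (2 * x)\<^sup>2 - d (2 * x)) * 2) (at x within {x0..y})"
        using has_real_derivative_iff_has_vector_derivative has_vector_derivative_at_within by blast
    qed
    moreover have "((\<lambda>x. 4 * (J (2 * x))\<^sup>2) has_integral 4 * integral {x0..y} (\<lambda>x. (J (2 * x))\<^sup>2)) {x0..y}"
      unfolding J_def
      by (intro has_integral_mult_right integrable_integral integrable_continuous_interval
          continuous_intros continuous_on_compose2[OF continuous_on_bessel_J[of UNIV]]) auto
    ultimately show ?thesis
    proof (rule has_integral_le)
      fix x assume "x \<in> {x0..y}"
      then show "(m / (2 * x) - C / (2 * x)\<^sup>2 - d (2 * x)) * 2 \<le> 4 * (J (2 * x))\<^sup>2"
        using main[of "2 * x"] x0 by simp
    qed
  qed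
  \<comment> \<open>Collects what stays bounded in \<open>y\<close>: the product \<open>J V\<close>
    at the upper end and the value of \<open>G\<close> at the lower end.\<close>
  define B where "B = K / (2 * x0) + \<bar>G (2 * x0)\<bar>"
  have "m / 4 * ln y - B / 4 \<le> integral {x0..y} (\<lambda>x. (J (2 * x))\<^sup>2)" if "y \<ge> x0" for y
  proof -
    have "0 \<le> C / (2 * y)"
      using that x0 \<open>K > 0\<close> by (simp add: C_def)
    moreover have "J (2 * y) * V (2 * y) \<le> K / (2 * x0)"
    proof -
      have "J (2 * y) * V (2 * y) \<le> K / (2 * (2 * y))" using JV[of "2 * y"] that x0 by simp
      also have "\<dots> \<le> K / (2 * x0)"
        using that x0 \<open>K > 0\<close> by (intro divide_left_mono) auto
      finally show ?thesis .
    qed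
    moreover have "G (2 * y) = m * ln (2 * y) + C / (2 * y) - J (2 * y) * V (2 * y)"
      by (simp add: G_def)
    moreover have "m * ln y \<le> m * ln (2 * y)"
      using that x0 m(1) by simp
    ultimately have "m * ln y - B \<le> 4 * integral {x0..y} (\<lambda>x. (J (2 * x))\<^sup>2)"
      using G[OF that] abs_ge_self[of "G (2 * x0)"] unfolding B_def by linarith
    then show ?thesis
      by simp
  qed
  then show ?thesis
    using that[of x0 "m / 4" "B / 4"] x0 m(1) unfolding J_def by simp
qed


section \<open>Integrability of the kernel\<close>

text \<open>The right-hand side is continuous and agrees with the quotient away from 0, so the
  \<open>Lim\<close> in the definition is its value at 0. From this formula \<open>H\<close>
  inherits continuity everywhere.\<close>

lemma H_eq_entire:
  assumes "n \<ge> 1"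
  shows "H n \<nu> r = real n * (r ^ (n - 1) * bessel_entire n (r\<^sup>2)) * exp (- \<nu> * r)"
proof -
  define F where "F r = real n * (r ^ (n - 1) * bessel_entire n (r\<^sup>2)) * exp (- \<nu> * r)" for r
  define h where "h x = (real n * (bessel_J n (2 * x) / x) * exp (- \<nu> * x))" for x
  have eq: "h x = F x" if "x \<noteq> 0" for x
    using that assms by (cases n) (auto simp: h_def F_def bessel_J_eq_entire power2_eq_square)
  have "continuous_on UNIV F"
    unfolding F_def by (intro continuous_intros)
  then have "F \<midarrow>0\<rightarrow> F 0"
    by (simp add: continuous_on_eq_continuous_at isCont_def)
  then have "h \<midarrow>0\<rightarrow> F 0"
    by (rule Lim_transform_eventually) (simp add: eventually_at_filter eq)
  then have "Lim (at 0) h = F 0"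
    by (intro tendsto_Lim) auto
  moreover have "H n \<nu> r = (if r = 0 then Lim (at 0) h else h r)"
    unfolding H_def h_def[abs_def] Let_def ..
  ultimately show ?thesis
    using eq by (simp add: F_def)
qed

lemma continuous_on_H: "n \<ge> 1 \<Longrightarrow> continuous_on S (H n \<nu>)"
proof -
  assume "n \<ge> 1"
  then have "H n \<nu> = (\<lambda>r. real n * (r ^ (n - 1) * bessel_entire n (r\<^sup>2)) * exp (- \<nu> * r))"
    by (intro ext H_eq_entire)
  then show ?thesis
    by (simp add: continuous_intros)
qed

lemma H_eq_H_0: "n \<ge> 1 \<Longrightarrow> H n \<nu> r = H n 0 r * exp (- \<nu> * r)"
  by (simp add: H_eq_entire)

lemma abs_H_powr:
  assumes "r > 0"
  shows "\<bar>H n \<nu> r\<bar> powr \<alpha> =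
    real n powr \<alpha> * (\<bar>bessel_J n (2 * r)\<bar> powr \<alpha> / r powr \<alpha> * exp (- \<alpha> * \<nu> * r))"
  using assms
  by (simp add: H_def abs_mult powr_mult powr_divide exp_powr_real mult_ac)


section \<open>Proper integrals over \<open>{0..T}\<close> and Lebesgue integrals over the half
  line\<close>

text \<open>Monotone convergence along the truncations to \<open>{0..k}\<close>. The origin is
  dropped at the end to match the domain of integration in the theorem.\<close>

lemma set_integrable_atLeast_0I:
  fixes f :: "real \<Rightarrow> real"
  assumes cont: "continuous_on {0..} f" and nonneg: "\<And>x. x \<ge> 0 \<Longrightarrow> f x \<ge> 0"
    and bound: "\<And>T::nat. integral {0..real T} f \<le> B"
  shows "set_integrable lborel {0<..} f"
proof -
  define g where "g k x = indicator {0..real k} x *\<^sub>R f x" for k x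
  have int: "set_integrable lborel {0..real k} f" for k
    by (intro borel_integrable_atLeastAtMost' continuous_on_subset[OF cont]) auto
  have int_eq: "integral\<^sup>L lborel (g k) = integral {0..real k} f" for k
    using set_borel_integral_eq_integral(2)[OF int[of k]]
    by (simp add: g_def[abs_def] set_lebesgue_integral_def)
  have mono: "g i x \<le> g j x" if "i \<le> j" for i j x
    using that nonneg by (auto simp: g_def indicator_def)
  have int_g: "integrable lborel (g k)" for k
    using int[of k] by (simp add: g_def[abs_def] set_integrable_def)
  have "incseq (\<lambda>k. integral\<^sup>L lborel (g k))"
    by (intro monoI integral_mono int_g mono)
  moreover have "\<forall>k. integral\<^sup>L lborel (g k) \<le> B"
    using bound by (simp add: int_eq)
  ultimately obtain l where l: "(\<lambda>k. integral\<^sup>L lborel (g k)) \<longlonglongrightarrow> l"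
    by (blast elim: incseq_convergent)
  have "integrable lborel (\<lambda>x. indicator {0..} x *\<^sub>R f x)"
  proof (rule integrable_monotone_convergence[OF _ _ _ l])
    show "integrable lborel (g k)" for k
      by (rule int_g)
    show "AE x in lborel. mono (\<lambda>k. g k x)"
      using mono by (auto simp: mono_def)
    show "AE x in lborel. (\<lambda>k. g k x) \<longlonglongrightarrow> indicator {0..} x *\<^sub>R f x"
    proof (intro AE_I2 tendsto_eventually)
      fix x :: real
      obtain N :: nat where "x \<le> real N" using real_arch_simple by blast
      then have "g k x = indicator {0..} x *\<^sub>R f x" if "k \<ge> N" for k
        using that by (auto simp: g_def indicator_def)
      then show "\<forall>\<^sub>F k in sequentially. g k x = indicator {0..} x *\<^sub>R f x"
        by (auto simp: eventually_sequentially)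
    qed
    show "(\<lambda>x. indicator {0..} x *\<^sub>R f x) \<in> borel_measurable lborel"
      using borel_measurable_continuous_on_indicator[OF _ cont] by simp
  qed
  then have "set_integrable lborel {0..} f"
    by (simp add: set_integrable_def)
  then show ?thesis
    by (rule set_integrable_subset) auto
qed

text \<open>Links the scales of the components, which are proper integrals, to the integral in the
  limit law. The closed and the open half line differ by the null set containing only 0.\<close>

lemma tendsto_integral_atLeast_0:
  fixes f :: "real \<Rightarrow> real"
  assumes cont: "continuous_on {0..} f" and int: "set_integrable lborel {0<..} f"
  shows "((\<lambda>T. integral {0..T} f) \<longlongrightarrow> (LINT x:{0<..}|lborel. f x)) at_top"
proof -
  have "((\<lambda>T. \<integral>x. indicator {..T} x *\<^sub>R (indicator {0<..} x *\<^sub>R f x) \<partial>lborel)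
      \<longlongrightarrow> (\<integral>x. indicator {0<..} x *\<^sub>R f x \<partial>lborel)) at_top"
    using int by (intro tendsto_integral_at_top) (auto simp: set_integrable_def)
  moreover have "(\<integral>x. indicator {..T} x *\<^sub>R (indicator {0<..} x *\<^sub>R f x) \<partial>lborel) = integral {0..T} f" for T
  proof -
    have "set_integrable lborel {0..T} f"
      by (intro borel_integrable_atLeastAtMost' continuous_on_subset[OF cont]) auto
    then have "integral {0..T} f = (\<integral>x. indicator {0..T} x *\<^sub>R f x \<partial>lborel)"
      using set_borel_integral_eq_integral(2)[of "{0..T}" f] by (simp add: set_lebesgue_integral_def)
    also have "\<dots> = (\<integral>x. indicator {..T} x *\<^sub>R (indicator {0<..} x *\<^sub>R f x) \<partial>lborel)"
    proof (rule integral_cong_AE)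
      show "AE x in lborel. indicator {0..T} x *\<^sub>R f x = indicator {..T} x *\<^sub>R (indicator {0<..} x *\<^sub>R f x)"
        using AE_lborel_singleton[of "0::real"] by eventually_elim (auto simp: indicator_def)
      show "(\<lambda>x. indicator {0..T} x *\<^sub>R f x) \<in> borel_measurable lborel"
        using borel_measurable_continuous_on_indicator[OF _ continuous_on_subset[OF cont, of "{0..T}"]] by auto
      have "(\<lambda>x. indicator {0<..} x *\<^sub>R f x) \<in> borel_measurable lborel"
        using int by (auto simp: set_integrable_def)
      then show "(\<lambda>x. indicator {..T} x *\<^sub>R (indicator {0<..} x *\<^sub>R f x)) \<in> borel_measurable lborel"
        by measurable
    qed
    finally show ?thesis by simp
  qed
  ultimately show ?thesis
    by (simp add: set_lebesgue_integral_def)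
qed

section \<open>Decay of the kernel and integrability of its powers\<close>

text \<open>Dividing the decay \<open>r powr (-1/2)\<close> of the Bessel function by
  \<open>r\<close> gives the exponent \<open>-3/2\<close>; on the compact rest, continuity bounds
  \<open>H\<close>. One constant \<open>B\<close> serves both estimates.\<close>

lemma abs_H_0_bounds:
  assumes "n \<ge> 1"
  obtains x0 B where "x0 \<ge> 1" "B > 0" "\<And>r. r \<ge> 0 \<Longrightarrow> \<bar>H n 0 r\<bar> \<le> B"
    "\<And>r. r \<ge> x0 \<Longrightarrow> \<bar>H n 0 r\<bar> \<le> B * r powr (- 3 / 2)"
proof -
  obtain x1 K where x1: "x1 > 0" and K: "\<And>x. x \<ge> x1 \<Longrightarrow> \<bar>bessel_J n x\<bar> \<le> K * x powr (-1/2)"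
    using abs_bessel_J_le[of n] by metis
  define x0 where "x0 = max x1 1"
  have decay: "\<bar>H n 0 r\<bar> \<le> real n * \<bar>K\<bar> * r powr (- 3 / 2)" if "r \<ge> x0" for r
  proof -
    have r: "r \<ge> 1" "r \<ge> x1" using that by (auto simp: x0_def)
    have "\<bar>bessel_J n (2 * r)\<bar> \<le> K * (2 * r) powr (-1/2)"
      using r by (intro K) auto
    also have "\<dots> \<le> \<bar>K\<bar> * r powr (-1/2)"
      using r by (intro mult_mono powr_mono2') auto
    finally have "\<bar>bessel_J n (2 * r)\<bar> / r \<le> \<bar>K\<bar> * r powr (-1/2) / r"
      using r by (intro divide_right_mono) auto
    also have "\<dots> = \<bar>K\<bar> * r powr (-1/2 - 1)"
      using r by (subst powr_diff) auto
    finally have "\<bar>bessel_J n (2 * r)\<bar> / r \<le> \<bar>K\<bar> * r powr (- 3 / 2)"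
      by simp
    then have "real n * (\<bar>bessel_J n (2 * r)\<bar> / r) \<le> real n * (\<bar>K\<bar> * r powr (- 3 / 2))"
      by (intro mult_left_mono) auto
    then show ?thesis
      using r by (simp add: H_def abs_mult)
  qed
  have "bounded (H n 0 ` {0..x0})"
    by (intro compact_imp_bounded compact_continuous_image continuous_on_H assms) auto
  then obtain B0 where "\<forall>r\<in>{0..x0}. \<bar>H n 0 r\<bar> \<le> B0"
    by (auto simp: bounded_iff)
  then have B0: "\<And>r. 0 \<le> r \<Longrightarrow> r \<le> x0 \<Longrightarrow> \<bar>H n 0 r\<bar> \<le> B0"
    by auto
  \<comment> \<open>The added 1 makes \<open>B\<close> strictly positive.\<close>
  define B where "B = max B0 (real n * \<bar>K\<bar>) + 1"
  have BK: "real n * \<bar>K\<bar> \<le> B" "B0 \<le> B" by (auto simp: B_def)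
  have decay': "\<bar>H n 0 r\<bar> \<le> B * r powr (- 3 / 2)" if "r \<ge> x0" for r
    using decay[OF that] mult_right_mono[OF BK(1), of "r powr (- 3 / 2)"] by simp
  have "\<bar>H n 0 r\<bar> \<le> B" if "r \<ge> 0" for r
  proof (cases "r \<le> x0")
    case True
    then show ?thesis using B0[OF that] BK by simp
  next
    case False
    then have "r \<ge> 1" by (simp add: x0_def)
    then have "r powr (- 3 / 2) \<le> r powr 0"
      by (intro powr_mono) auto
    then have "r powr (- 3 / 2) \<le> 1"
      using \<open>r \<ge> 1\<close> by simp
    moreover have "B \<ge> 0"
      using BK(1) mult_nonneg_nonneg[of "real n" "\<bar>K\<bar>"] by linarith
    ultimately have "B * r powr (- 3 / 2) \<le> B * 1"
      by (rule mult_left_mono)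
    then show ?thesis using decay'[of r] False by simp
  qed
  moreover have "B > 0"
    using mult_nonneg_nonneg[of "real n" "\<bar>K\<bar>"] unfolding B_def by linarith
  ultimately show ?thesis
    using that[of x0 B] decay' by (simp add: x0_def)
qed

lemma continuous_on_abs_H_powr:
  "n \<ge> 1 \<Longrightarrow> \<alpha> > 0 \<Longrightarrow> continuous_on S (\<lambda>r. \<bar>H n \<nu> r\<bar> powr \<alpha>)"
  by (intro continuous_on_powr' continuous_intros continuous_on_H) auto

lemma integral_le_of_le_integrable_on_atLeast:
  fixes f g :: "real \<Rightarrow> real"
  assumes "continuous_on {a..b} f" "\<And>x. x \<ge> a \<Longrightarrow> 0 \<le> g x" "\<And>x. x \<ge> a \<Longrightarrow> f x \<le> g x"
    "g integrable_on {a..}"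
  shows "integral {a..b} f \<le> integral {a..} g"
proof -
  have g: "g integrable_on {a..b}"
    by (rule integrable_on_subinterval[OF assms(4)]) auto
  have "integral {a..b} f \<le> integral {a..b} g"
    using assms by (intro integral_le g integrable_continuous_interval) auto
  also have "\<dots> \<le> integral {a..} g"
    using assms by (intro integral_subset_le g) auto
  finally show ?thesis .
qed

text \<open>For \<open>\<nu> > 0\<close> the exponential factor dominates a bounded function; for
  \<open>\<nu> = 0\<close> the decay of \<open>H n 0\<close> alone has to suffice.\<close>

lemma set_integrable_abs_H_powr:
  assumes n: "n \<ge> 1" and "\<alpha> > 0" and "\<nu> > 0 \<or> \<nu> = 0 \<and> \<alpha> > 2 / 3"
  shows "set_integrable lborel {0<..} (\<lambda>r. \<bar>H n \<nu> r\<bar> powr \<alpha>)"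
proof -
  obtain x0 B where x0: "x0 \<ge> 1" and B: "B > 0" "\<And>r. r \<ge> 0 \<Longrightarrow> \<bar>H n 0 r\<bar> \<le> B"
    "\<And>r. r \<ge> x0 \<Longrightarrow> \<bar>H n 0 r\<bar> \<le> B * r powr (- 3 / 2)"
    using abs_H_0_bounds[OF n] by metis
  let ?f = "\<lambda>r. \<bar>H n \<nu> r\<bar> powr \<alpha>"
  have cont: "continuous_on S ?f" for S
    by (intro continuous_on_abs_H_powr assms)
  have "\<exists>C. \<forall>T::nat. integral {0..real T} ?f \<le> C"
  proof (cases "\<nu> > 0")
    case True
    have le: "?f r \<le> B powr \<alpha> * exp (- (\<alpha> * \<nu>) * r)" if "r \<ge> 0" for r
    proof -
      have "?f r \<le> (B * exp (- \<nu> * r)) powr \<alpha>"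
        using B(2)[OF that] \<open>\<alpha> > 0\<close> by (intro powr_mono2) (auto simp: H_eq_H_0[OF n, of \<nu>] abs_mult)
      then show ?thesis
        using B by (simp add: powr_mult exp_powr_real mult_ac)
    qed
    have "(\<lambda>r. B powr \<alpha> * exp (- (\<alpha> * \<nu>) * r)) integrable_on {0..}"
      using True \<open>\<alpha> > 0\<close> by (intro integrable_on_mult_right integrable_on_exp_minus_to_infinity) auto
    then show ?thesis
      by (intro exI[of _ "integral {0..} (\<lambda>r. B powr \<alpha> * exp (- (\<alpha> * \<nu>) * r))"] allI
          integral_le_of_le_integrable_on_atLeast cont le) auto
  next
    case False
    with assms have \<nu>: "\<nu> = 0" "\<alpha> > 2 / 3" by auto
    \<comment> \<open>Integrability of \<open>r powr e\<close> at infinity means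
      \<open>e < -1\<close>, which is exactly \<open>\<alpha> > 2 / 3\<close>.\<close>
    define e where "e = - 3 / 2 * \<alpha>"
    have le: "?f r \<le> B powr \<alpha> * r powr e" if "r \<ge> x0" for r
    proof -
      have "?f r \<le> (B * r powr (- 3 / 2)) powr \<alpha>"
        using B(3)[OF that] \<open>\<alpha> > 0\<close> \<nu> by (intro powr_mono2) auto
      then show ?thesis
        using B by (simp add: powr_mult powr_powr e_def)
    qed
    have "(\<lambda>r. r powr e) integrable_on {x0..}"
      using has_integral_powr_to_inf[of e x0] x0 \<nu> by (auto simp: e_def integrable_on_def)
    then have int: "(\<lambda>r. B powr \<alpha> * r powr e) integrable_on {x0..}"
      by (rule integrable_on_mult_right)
    have ge: "integral {x0..b} ?f \<le> integral {x0..} (\<lambda>r. B powr \<alpha> * r powr e)" for b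
      using le int by (intro integral_le_of_le_integrable_on_atLeast cont) auto
    show ?thesis
    proof (intro exI allI)
      fix T :: nat
      have "integral {0..real T} ?f \<le> integral {0..max x0 (real T)} ?f"
        by (intro integral_subset_le integrable_continuous_interval cont) auto
      also have "\<dots> = integral {0..x0} ?f + integral {x0..max x0 (real T)} ?f"
        using x0 by (intro Henstock_Kurzweil_Integration.integral_combine[symmetric] integrable_continuous_interval cont) auto
      also have "\<dots> \<le> integral {0..x0} ?f + integral {x0..} (\<lambda>r. B powr \<alpha> * r powr e)"
        using ge by simp
      finally show "integral {0..real T} ?f \<le> integral {0..x0} ?f + integral {x0..} (\<lambda>r. B powr \<alpha> * r powr e)" .
    qed
  qed
  then show ?thesis
    using set_integrable_atLeast_0I[OF cont] by auto
qed

lemma not_set_integrable_abs_H_0_powr: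
  assumes n: "n \<ge> 1" and \<alpha>: "0 < \<alpha>" "\<alpha> \<le> 2 / 3"
  shows "\<not> set_integrable lborel {0<..} (\<lambda>r. \<bar>H n 0 r\<bar> powr \<alpha>)"
proof
  let ?f = "\<lambda>r. \<bar>H n 0 r\<bar> powr \<alpha>"
  have cont: "continuous_on S ?f" for S
    by (intro continuous_on_abs_H_powr assms)
  assume "set_integrable lborel {0<..} ?f"
  then have lim: "((\<lambda>T. integral {0..T} ?f) \<longlongrightarrow> (LINT x:{0<..}|lborel. ?f x)) at_top"
    by (intro tendsto_integral_atLeast_0 cont)
  obtain x0 B where x0: "x0 \<ge> 1" and B: "B > 0" "\<And>r. r \<ge> 0 \<Longrightarrow> \<bar>H n 0 r\<bar> \<le> B"
    "\<And>r. r \<ge> x0 \<Longrightarrow> \<bar>H n 0 r\<bar> \<le> B * r powr (- 3 / 2)"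
    using abs_H_0_bounds[OF n] by metis
  obtain x1 m C where x1: "x1 > 0" "m > 0"
    and ge: "\<And>y. y \<ge> x1 \<Longrightarrow> m * ln y - C \<le> integral {x1..y} (\<lambda>x. (bessel_J n (2 * x))\<^sup>2)"
    using integral_bessel_J_squared_ge[of n] by metis
  define x2 where "x2 = max x0 x1"
  define D where "D = B powr (2 - \<alpha>)"
  let ?J = "\<lambda>r. (bessel_J n (2 * r))\<^sup>2"
  have contJ: "continuous_on S ?J" for S
    by (intro continuous_intros continuous_on_compose2[OF continuous_on_bessel_J[of UNIV]]) auto
  \<comment> \<open>\<open>\<alpha> \<le> 2/3\<close> makes the power \<open>r powr (2 - 3/2 (2 - \<alpha>))\<close> bounded at infinity.\<close>
  have le: "?J r \<le> D * ?f r" if "r \<ge> x2" for r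
  proof -
    have r: "r \<ge> 1" "r \<ge> x0" using that x0 by (auto simp: x2_def)
    have J: "bessel_J n (2 * r) = H n 0 r * r / real n"
      using r n by (simp add: H_def)
    have "?J r = (\<bar>H n 0 r\<bar> * r)\<^sup>2 / (real n)\<^sup>2"
      by (simp add: J power_divide power_mult_distrib)
    also have "\<dots> \<le> (\<bar>H n 0 r\<bar> * r)\<^sup>2 / 1"
      using n by (intro divide_left_mono) auto
    also have "\<dots> = (\<bar>H n 0 r\<bar> * r)\<^sup>2"
      by simp
    \<comment> \<open>One factor \<open>\<bar>H\<bar> powr \<alpha>\<close> is kept; the decay is
      spent on the remaining positive power \<open>2 - \<alpha>\<close>. Where \<open>H\<close>
      vanishes both sides are 0.\<close>
    also have "\<dots> = \<bar>H n 0 r\<bar> powr (2 - \<alpha>) * r powr 2 * ?f r"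
      using r by (cases "H n 0 r = 0") (simp_all add: power_mult_distrib powr_diff)
    also have "\<dots> \<le> (B * r powr (- 3 / 2)) powr (2 - \<alpha>) * r powr 2 * ?f r"
      using \<alpha> r B(3)[of r] by (intro mult_right_mono powr_mono2) auto
    also have "\<dots> = D * r powr (- 3 / 2 * (2 - \<alpha>) + 2) * ?f r"
      unfolding powr_add using B by (simp add: powr_mult powr_powr D_def)
    also have "\<dots> \<le> D * r powr 0 * ?f r"
      using \<alpha> r by (intro mult_right_mono mult_left_mono powr_mono) (auto simp: D_def)
    finally show ?thesis using r by simp
  qed
  have bound: "m * ln T - C \<le> integral {x1..x2} ?J + D * integral {0..T} ?f" if "T \<ge> x2" for T
  proof -
    have "x1 \<le> x2" "0 \<le> x2" using x0 by (auto simp: x2_def)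
    have "m * ln T - C \<le> integral {x1..T} ?J"
      using that by (intro ge) (auto simp: x2_def)
    also have "\<dots> = integral {x1..x2} ?J + integral {x2..T} ?J"
      using that \<open>x1 \<le> x2\<close> by (intro Henstock_Kurzweil_Integration.integral_combine[symmetric] integrable_continuous_interval contJ) auto
    also have "integral {x2..T} ?J \<le> integral {x2..T} (\<lambda>r. D * ?f r)"
      using le by (intro integral_le integrable_continuous_interval contJ continuous_intros cont) auto
    also have "\<dots> = D * integral {x2..T} ?f"
      by simp
    also have "\<dots> \<le> D * integral {0..T} ?f"
      using \<open>0 \<le> x2\<close>
      by (intro mult_left_mono integral_subset_le integrable_continuous_interval cont) (auto simp: D_def)
    finally show ?thesis by simp
  qed
  have "filterlim (\<lambda>T. m * ln T - C) at_top at_top"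
    using x1 by real_asymp
  moreover have "eventually (\<lambda>T. m * ln T - C \<le> integral {x1..x2} ?J + D * integral {0..T} ?f) at_top"
    using eventually_ge_at_top[of x2] by eventually_elim (rule bound)
  ultimately have "filterlim (\<lambda>T. integral {x1..x2} ?J + D * integral {0..T} ?f) at_top at_top"
    by (rule filterlim_at_top_mono)
  moreover have "((\<lambda>T. integral {x1..x2} ?J + D * integral {0..T} ?f) \<longlongrightarrow>
      integral {x1..x2} ?J + D * (LINT x:{0<..}|lborel. ?f x)) at_top"
    by (intro tendsto_intros lim)
  ultimately show False
    using not_tendsto_and_filterlim_at_infinity[OF _ _ filterlim_at_top_imp_at_infinity] by force
qed

text \<open>\<open>H\<close> has no zeros just to the right of 0, a set of positive measure.
  Positivity excludes a point mass as limit law, as the definition of stability demands.\<close>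

lemma integral_abs_H_powr_pos:
  assumes n: "n \<ge> 1" and "set_integrable lborel {0<..} (\<lambda>r. \<bar>H n \<nu> r\<bar> powr \<alpha>)"
  shows "(LINT r:{0<..}|lborel. \<bar>H n \<nu> r\<bar> powr \<alpha>) > 0"
proof -
  obtain x0 where x0: "x0 > 0" "\<And>x. 0 < x \<Longrightarrow> x < x0 \<Longrightarrow> bessel_J n x \<noteq> 0"
    using bessel_J_nonzero_near_0 by metis
  let ?f = "\<lambda>r. \<bar>H n \<nu> r\<bar> powr \<alpha>"
  have "(LINT r:{0<..}|lborel. ?f r) \<noteq> 0"
  proof
    assume "(LINT r:{0<..}|lborel. ?f r) = 0"
    then have "AE r in lborel. indicator {0<..} r *\<^sub>R ?f r = 0"
      using assms(2) unfolding set_lebesgue_integral_def set_integrable_def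
      by (subst (asm) integral_nonneg_eq_0_iff_AE) auto
    then have "AE r in lborel. r \<notin> {0<..<x0 / 2}"
    proof eventually_elim
      case (elim r)
      show ?case
      proof
        assume r: "r \<in> {0<..<x0 / 2}"
        then have "H n \<nu> r \<noteq> 0"
          using x0(2)[of "2 * r"] n by (simp add: H_def)
        with elim r show False by simp
      qed
    qed
    then have "emeasure lborel {0<..<x0 / 2} = 0"
      by (subst (asm) AE_iff_measurable[where N = "{0<..<x0 / 2}"]) auto
    with x0 show False by simp
  qed
  moreover have "(LINT r:{0<..}|lborel. ?f r) \<ge> 0"
    unfolding set_lebesgue_integral_def by (intro integral_nonneg_AE) auto
  ultimately show ?thesis by simp
qed

section \<open>Riemann sums and convergence in probability\<close>

definition riemann_sum ::
  "(real \<Rightarrow> 'a \<Rightarrow> real) \<Rightarrow> (real \<Rightarrow> real) \<Rightarrow> nat \<Rightarrow> (nat \<Rightarrow> real) \<Rightarrow> 'a \<Rightarrow> real" where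
  "riemann_sum X f N t \<omega> = (\<Sum>i<N. f (t i) * (X (t (Suc i)) \<omega> - X (t i) \<omega>))"

text \<open>Repeated points are allowed, as in \<open>has_stochastic_integral\<close>; the common
  refinements below are strictly increasing.\<close>

definition partition_below :: "real \<Rightarrow> real \<Rightarrow> real \<Rightarrow> nat \<Rightarrow> (nat \<Rightarrow> real) \<Rightarrow> bool" where
  "partition_below a b d N t \<longleftrightarrow>
     t 0 = a \<and> t N = b \<and> (\<forall>i<N. t i \<le> t (Suc i) \<and> t (Suc i) - t i < d)"

lemma has_stochastic_integral_iff:
  "has_stochastic_integral M X f a b I \<longleftrightarrow>
     I \<in> borel_measurable M \<and>
     (\<forall>e>0. \<exists>d>0. \<forall>N t. partition_below a b d N t \<longrightarrow>
        measure M {\<omega> \<in> space M. \<bar>riemann_sum X f N t \<omega> - I \<omega>\<bar> > e} < e)"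
  by (simp add: has_stochastic_integral_def riemann_sum_def partition_below_def)

lemma partition_below_mono:
  assumes "partition_below a b d N t" "i \<le> j" "j \<le> N"
  shows "t i \<le> t j"
  using assms(2,3)
proof (induction rule: dec_induct)
  case (step k)
  then have "t k \<le> t (Suc k)"
    using assms(1) by (auto simp: partition_below_def)
  with step show ?case by simp
qed simp

lemma partition_below_bounds:
  assumes "partition_below a b d N t" "i \<le> N"
  shows "a \<le> t i" "t i \<le> b"
  using partition_below_mono[OF assms(1), of 0 i] partition_below_mono[OF assms(1) assms(2)] assms
  by (auto simp: partition_below_def)

text \<open>The step function whose integral against \<open>X\<close> is the left-endpoint Riemann
  sum. Refining the partition does not change it, so sums over different partitions become
  comparable. The half-open intervals let repeated points contribute nothing.\<close>

definition step_fun :: "(real \<Rightarrow> real) \<Rightarrow> nat \<Rightarrow> (nat \<Rightarrow> real) \<Rightarrow> real \<Rightarrow> real" where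
  "step_fun f N t r = (\<Sum>i<N. f (t i) * indicator {t i..<t (Suc i)} r)"

lemma step_fun_eq:
  assumes t: "partition_below a b d N t" and r: "a \<le> r" "r < b"
  obtains i where "i < N" "t i \<le> r" "r < t (Suc i)" "step_fun f N t r = f (t i)"
proof -
  \<comment> \<open>The last such index: with repeated points, this selects the nonempty interval
    that contains \<open>r\<close>.\<close>
  define i where "i = Max {i. i \<le> N \<and> t i \<le> r}"
  have "0 \<in> {i. i \<le> N \<and> t i \<le> r}"
    using t r by (auto simp: partition_below_def)
  then have i: "i \<in> {i. i \<le> N \<and> t i \<le> r}"
    unfolding i_def by (intro Max_in) auto
  have max: "j \<le> i" if "j \<le> N" "t j \<le> r" for j
    unfolding i_def by (rule Max_ge) (use that in auto)
  have "i \<noteq> N"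
    using i t r by (auto simp: partition_below_def)
  with i have "i < N" "t i \<le> r" by auto
  moreover have "r < t (Suc i)"
    using max[of "Suc i"] \<open>i < N\<close> by fastforce
  moreover have "step_fun f N t r = (\<Sum>j<N. if j = i then f (t i) else 0)"
    unfolding step_fun_def
  proof (rule sum.cong)
    fix j assume "j \<in> {..<N}"
    then have j: "j < N" by simp
    consider "j = i" | "j < i" | "j > i" by linarith
    then show "f (t j) * indicator {t j..<t (Suc j)} r = (if j = i then f (t i) else 0)"
    proof cases
      case 1
      then show ?thesis using \<open>t i \<le> r\<close> \<open>r < t (Suc i)\<close> by simp
    next
      case 2
      then have "t (Suc j) \<le> t i"
        using \<open>i < N\<close> by (intro partition_below_mono[OF t]) auto
      then show ?thesis using 2 \<open>t i \<le> r\<close> by simp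
    next
      case 3
      then have "t (Suc i) \<le> t j"
        using j by (intro partition_below_mono[OF t]) auto
      then show ?thesis using 3 \<open>r < t (Suc i)\<close> by simp
    qed
  qed simp
  then have "step_fun f N t r = f (t i)"
    using \<open>i < N\<close> by simp
  ultimately show ?thesis using that by blast
qed

lemma step_fun_approx:
  assumes t: "partition_below a b d N t" and r: "a \<le> r" "r < b"
    and f: "\<And>x y. x \<in> {a..b} \<Longrightarrow> y \<in> {a..b} \<Longrightarrow> \<bar>x - y\<bar> < d \<Longrightarrow> \<bar>f x - f y\<bar> \<le> e"
  shows "\<bar>step_fun f N t r - f r\<bar> \<le> e"
proof -
  obtain i where i: "i < N" "t i \<le> r" "r < t (Suc i)" "step_fun f N t r = f (t i)"
    using step_fun_eq[OF t r] by metis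
  moreover have "t (Suc i) - t i < d"
    using t i by (auto simp: partition_below_def)
  ultimately show ?thesis
    using partition_below_bounds[OF t, of i] r by (auto intro!: f)
qed

text \<open>Strict monotonicity turns the indicator on points into one on indices, after which the
  sum telescopes.\<close>

lemma sum_diff_between:
  fixes u :: "nat \<Rightarrow> real"
  assumes u: "strict_mono_on {..K} u" and pq: "p \<le> q" "q \<le> K"
  shows "(\<Sum>j<K. indicator {u p..<u q} (u j) * (Y (u (Suc j)) - Y (u j))) = (Y (u q) - Y (u p) :: real)"
proof -
  have eq: "indicator {u p..<u q} (u j) = (indicator {p..<q} j :: real)" if "j < K" for j
    using strict_mono_on_less[OF u, of j q] strict_mono_on_leD[OF u, of p j]
      strict_mono_on_less[OF u, of j p] that pq
    by (auto simp: indicator_def not_less)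
  have "(\<Sum>j<K. indicator {u p..<u q} (u j) * (Y (u (Suc j)) - Y (u j))) =
      (\<Sum>j<K. indicator {p..<q} j * (Y (u (Suc j)) - Y (u j)))"
    by (intro sum.cong) (auto simp: eq)
  also have "\<dots> = (\<Sum>j=p..<q. Y (u (Suc j)) - Y (u j))"
    using pq by (intro sum.mono_neutral_cong_right) auto
  also have "\<dots> = Y (u q) - Y (u p)"
    using sum_Suc_diff'[of p q "\<lambda>j. Y (u j)"] pq by simp
  finally show ?thesis .
qed

text \<open>Each coarse increment is a telescoping sum of fine ones; exchanging the two sums
  collects the step function as the coefficient of each fine increment.\<close>

lemma riemann_sum_refine:
  assumes t: "partition_below a b d N t" and u: "strict_mono_on {..K} u"
    and sub: "t ` {..N} \<subseteq> u ` {..K}"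
  shows "riemann_sum X f N t \<omega> = (\<Sum>j<K. step_fun f N t (u j) * (X (u (Suc j)) \<omega> - X (u j) \<omega>))"
proof -
  have *: "(\<Sum>j<K. indicator {t i..<t (Suc i)} (u j) * (X (u (Suc j)) \<omega> - X (u j) \<omega>)) =
      X (t (Suc i)) \<omega> - X (t i) \<omega>" if "i < N" for i
  proof -
    have "t i \<in> u ` {..K}" "t (Suc i) \<in> u ` {..K}"
      using sub that by auto
    then obtain p q where pq: "p \<le> K" "q \<le> K" "t i = u p" "t (Suc i) = u q"
      by auto
    have "u p \<le> u q"
      using t that unfolding pq(3,4)[symmetric] by (simp add: partition_below_def)
    then have "p \<le> q"
      using strict_mono_on_less_eq[OF u] pq by auto
    then show ?thesis
      using sum_diff_between[OF u _ pq(2), of p "\<lambda>x. X x \<omega>"] pq by simp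
  qed
  have "riemann_sum X f N t \<omega> = (\<Sum>i<N. f (t i) *
      (\<Sum>j<K. indicator {t i..<t (Suc i)} (u j) * (X (u (Suc j)) \<omega> - X (u j) \<omega>)))"
    unfolding riemann_sum_def by (intro sum.cong refl arg_cong2[of _ _ _ _ "(*)"] *[symmetric]) simp
  also have "\<dots> = (\<Sum>j<K. step_fun f N t (u j) * (X (u (Suc j)) \<omega> - X (u j) \<omega>))"
    unfolding step_fun_def sum_distrib_left sum_distrib_right
    by (subst sum.swap) (simp add: mult.assoc)
  finally show ?thesis .
qed

text \<open>The sorted list of the union of both point sets has no repetitions, which yields strict
  monotonicity.\<close>

lemma common_refinement:
  assumes t: "partition_below a b d N t" and t': "partition_below a b d' N' t'"
  obtains K u where "strict_mono_on {..K} u" "u 0 = a" "u K = b"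
    "t ` {..N} \<subseteq> u ` {..K}" "t' ` {..N'} \<subseteq> u ` {..(K::nat)}"
proof -
  define U where "U = t ` {..N} \<union> t' ` {..N'}"
  define xs where "xs = sorted_list_of_set U"
  define K where "K = length xs - 1"
  have U: "finite U" "a \<in> U" "b \<in> U"
    using t by (auto simp: U_def partition_below_def intro: image_eqI[of _ _ 0] image_eqI[of _ _ N])
  have bounds: "a \<le> x \<and> x \<le> b" if "x \<in> U" for x
    using that partition_below_bounds[OF t] partition_below_bounds[OF t'] by (auto simp: U_def)
  have set: "set xs = U"
    using U by (simp add: xs_def)
  then have "xs \<noteq> []" using U by auto
  then have len: "length xs = Suc K" by (simp add: K_def)
  have sorted: "sorted_wrt (<) xs" by (simp add: xs_def)
  have mono: "strict_mono_on {..K} (\<lambda>i. xs ! i)"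
    using sorted len by (auto intro!: strict_mono_onI simp: sorted_wrt_iff_nth_less)
  have im: "(\<lambda>i. xs ! i) ` {..K} = U"
    using len by (auto simp: set[symmetric] set_conv_nth less_Suc_eq_le)
  obtain i where i: "i \<le> K" "xs ! i = a" using im U by (metis (no_types, lifting) atMost_iff imageE)
  obtain j where j: "j \<le> K" "xs ! j = b" using im U by (metis (no_types, lifting) atMost_iff imageE)
  have "xs ! 0 \<le> a" "b \<le> xs ! K"
    using strict_mono_on_leD[OF mono, of 0 i] strict_mono_on_leD[OF mono, of j K] i j by auto
  moreover have "a \<le> xs ! 0" "xs ! K \<le> b"
    using bounds im by auto
  ultimately have "xs ! 0 = a" "xs ! K = b" by simp_all
  then show ?thesis
    using that[OF mono] im by (auto simp: U_def)
qed

text \<open>Induction on the number of intervals with the right end \<open>b\<close> generalised: on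
  the last interval \<open>{c..b}\<close> the function stays within \<open>e\<close> of
  \<open>g c\<close>, which adds at most \<open>e * (b - c)\<close> to the error.\<close>

lemma riemann_sum_error:
  fixes g :: "real \<Rightarrow> real"
  assumes "partition_below a b d N t" "continuous_on {a..b} g"
    and "\<And>x y. x \<in> {a..b} \<Longrightarrow> y \<in> {a..b} \<Longrightarrow> \<bar>x - y\<bar> < d \<Longrightarrow> \<bar>g x - g y\<bar> \<le> e"
  shows "\<bar>integral {a..b} g - (\<Sum>i<N. g (t i) * (t (Suc i) - t i))\<bar> \<le> e * (b - a)"
  using assms
proof (induction N arbitrary: b)
  case 0
  then have "a = b" by (simp add: partition_below_def)
  then show ?case by simp
next
  case (Suc N)
  define c where "c = t N"
  have c: "a \<le> c" "c \<le> b"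
    using partition_below_bounds[OF Suc.prems(1), of N] by (auto simp: c_def)
  have b: "b = t (Suc N)" "b - c < d"
    using Suc.prems(1) by (auto simp: partition_below_def c_def)
  have "partition_below a c d N t"
    using Suc.prems(1) by (auto simp: partition_below_def c_def)
  then have IH: "\<bar>integral {a..c} g - (\<Sum>i<N. g (t i) * (t (Suc i) - t i))\<bar> \<le> e * (c - a)"
    using c by (intro Suc.IH continuous_on_subset[OF Suc.prems(2)] Suc.prems(3)) auto
  have int: "g integrable_on {c..b}" "g integrable_on {a..b}"
    using c by (auto intro!: integrable_continuous_interval continuous_on_subset[OF Suc.prems(2)])
  have "norm (integral {c..b} (\<lambda>x. g x - g c)) \<le> e * (b - c)"
  proof (rule integral_bound[OF c(2)])
    show "continuous_on {c..b} (\<lambda>x. g x - g c)"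
      using c by (intro continuous_intros continuous_on_subset[OF Suc.prems(2)]) auto
    show "norm (g x - g c) \<le> e" if "x \<in> {c..b}" for x
      using that c b by (auto intro!: Suc.prems(3))
  qed
  moreover have "integral {c..b} (\<lambda>x. g x - g c) = integral {c..b} g - g c * (b - c)"
    using int(1) c by (subst Henstock_Kurzweil_Integration.integral_diff) auto
  moreover have "integral {a..b} g = integral {a..c} g + integral {c..b} g"
    by (rule Henstock_Kurzweil_Integration.integral_combine[symmetric, OF c int(2)])
  ultimately show ?case
    using IH by (simp add: b(1)[symmetric] c_def[symmetric] algebra_simps abs_le_iff)
qed

lemma uniformly_continuous_modulus:
  fixes g :: "real \<Rightarrow> real"
  assumes "continuous_on {a..b} g" "e > 0"
  obtains d where "d > 0"
    "\<And>x y. x \<in> {a..b} \<Longrightarrow> y \<in> {a..b} \<Longrightarrow> \<bar>x - y\<bar> < d \<Longrightarrow> \<bar>g x - g y\<bar> \<le> e"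
proof -
  have "uniformly_continuous_on {a..b} g"
    by (rule compact_uniformly_continuous[OF assms(1)]) simp
  then show ?thesis
    using that assms(2) by (force simp: uniformly_continuous_on_def dist_real_def)
qed

text \<open>There are \<open>Suc k\<close> intervals, so that every \<open>k\<close>, including 0,
  gives a partition.\<close>

definition uniform_partition :: "real \<Rightarrow> real \<Rightarrow> nat \<Rightarrow> nat \<Rightarrow> real" where
  "uniform_partition a b k i = a + real i * (b - a) / real (Suc k)"

lemma partition_below_uniform:
  assumes "a \<le> b" "(b - a) / real (Suc k) < d"
  shows "partition_below a b d (Suc k) (uniform_partition a b k)"
  unfolding partition_below_def
proof (intro conjI allI impI)
  have diff: "uniform_partition a b k (Suc i) - uniform_partition a b k i = (b - a) / real (Suc k)" for i
    by (simp add: uniform_partition_def add_divide_distrib distrib_right)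
  fix i
  show "uniform_partition a b k (Suc i) - uniform_partition a b k i < d"
    using assms(2) by (simp only: diff)
  have "0 \<le> (b - a) / real (Suc k)" using assms by simp
  then show "uniform_partition a b k i \<le> uniform_partition a b k (Suc i)"
    using diff[of i] by linarith
qed (simp_all add: uniform_partition_def)

lemma eventually_partition_below_uniform:
  assumes "a \<le> b" "d > 0"
  shows "eventually (\<lambda>k. partition_below a b d (Suc k) (uniform_partition a b k)) sequentially"
proof -
  have "(\<lambda>k. (b - a) / real (Suc k)) \<longlonglongrightarrow> 0"
    by (rule LIMSEQ_Suc[OF lim_const_over_n])
  then have "eventually (\<lambda>k. (b - a) / real (Suc k) < d) sequentially"
    using assms(2) by (auto dest: order_tendstoD(2))
  then show ?thesis
    by eventually_elim (rule partition_below_uniform[OF assms(1)])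
qed

section \<open>Convergence in probability and its effect on characteristic functions\<close>

context prob_space
begin

lemma prob_le_add_of_abs_le:
  assumes [measurable]: "X \<in> borel_measurable M" "Y \<in> borel_measurable M" "Z \<in> borel_measurable M"
    and "\<And>\<omega>. \<bar>X \<omega>\<bar> \<le> \<bar>Y \<omega>\<bar> + \<bar>Z \<omega>\<bar>"
  shows "prob {\<omega> \<in> space M. \<bar>X \<omega>\<bar> > e + d} \<le>
    prob {\<omega> \<in> space M. \<bar>Y \<omega>\<bar> > e} + prob {\<omega> \<in> space M. \<bar>Z \<omega>\<bar> > (d::real)}"
proof -
  have "prob {\<omega> \<in> space M. \<bar>X \<omega>\<bar> > e + d} \<le>
      prob ({\<omega> \<in> space M. \<bar>Y \<omega>\<bar> > e} \<union> {\<omega> \<in> space M. \<bar>Z \<omega>\<bar> > d})"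
  proof (intro finite_measure_mono subsetI)
    fix \<omega> assume "\<omega> \<in> {\<omega> \<in> space M. \<bar>X \<omega>\<bar> > e + d}"
    then show "\<omega> \<in> {\<omega> \<in> space M. \<bar>Y \<omega>\<bar> > e} \<union> {\<omega> \<in> space M. \<bar>Z \<omega>\<bar> > d}"
      using assms(4)[of \<omega>] by auto
  qed auto
  also have "\<dots> \<le> prob {\<omega> \<in> space M. \<bar>Y \<omega>\<bar> > e} + prob {\<omega> \<in> space M. \<bar>Z \<omega>\<bar> > d}"
    by (intro measure_Un_le) auto
  finally show ?thesis .
qed

lemma AE_tendsto_imp_prob_tendsto_0:
  fixes Y :: "nat \<Rightarrow> 'a \<Rightarrow> real"
  assumes [measurable]: "\<And>k. Y k \<in> borel_measurable M" "I \<in> borel_measurable M"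
    and lim: "AE \<omega> in M. (\<lambda>k. Y k \<omega>) \<longlonglongrightarrow> I \<omega>" and e: "e > 0"
  shows "(\<lambda>k. prob {\<omega> \<in> space M. \<bar>Y k \<omega> - I \<omega>\<bar> > e}) \<longlonglongrightarrow> 0"
proof -
  have "(\<lambda>k. \<integral>\<omega>. indicator {\<omega> \<in> space M. \<bar>Y k \<omega> - I \<omega>\<bar> > e} \<omega> \<partial>M) \<longlonglongrightarrow> (\<integral>\<omega>. (0::real) \<partial>M)"
  proof (rule integral_dominated_convergence)
    show "AE \<omega> in M. (\<lambda>k. indicator {\<omega> \<in> space M. \<bar>Y k \<omega> - I \<omega>\<bar> > e} \<omega>) \<longlonglongrightarrow> (0::real)"
      using lim
    proof eventually_elim
      case (elim \<omega>)
      then have "eventually (\<lambda>k. dist (Y k \<omega>) (I \<omega>) < e) sequentially"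
        using e by (rule tendstoD)
      then show ?case
        by (intro tendsto_eventually) (auto elim!: eventually_mono simp: dist_real_def indicator_def)
    qed
    show "AE \<omega> in M. norm (indicator {\<omega> \<in> space M. \<bar>Y k \<omega> - I \<omega>\<bar> > e} \<omega> :: real) \<le> 1" for k
      by (auto simp: indicator_def)
  qed auto
  then show ?thesis
    by simp
qed

text \<open>Completeness of convergence in probability. Along a fast subsequence, Borel-Cantelli
  makes the differences eventually smaller than a geometric sequence, so it converges almost surely;
  the Cauchy property carries the whole sequence along.\<close>

lemma Cauchy_in_probability_imp_convergent:
  fixes Y :: "nat \<Rightarrow> 'a \<Rightarrow> real"
  assumes Y[measurable]: "\<And>k. Y k \<in> borel_measurable M"
    and Cauchy: "\<And>e. e > 0 \<Longrightarrow> \<exists>K. \<forall>i\<ge>K. \<forall>j\<ge>K. prob {\<omega> \<in> space M. \<bar>Y i \<omega> - Y j \<omega>\<bar> > e} < e"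
  shows "\<exists>I\<in>borel_measurable M.
    \<forall>e>0. \<exists>K. \<forall>i\<ge>K. prob {\<omega> \<in> space M. \<bar>Y i \<omega> - I \<omega>\<bar> > e} < e"
proof -
  have "\<forall>m. \<exists>K. \<forall>i\<ge>K. \<forall>j\<ge>K. prob {\<omega> \<in> space M. \<bar>Y i \<omega> - Y j \<omega>\<bar> > (1/2)^m} < (1/2)^m"
    by (intro allI Cauchy) simp
  then obtain K where K: "\<And>m i j. i \<ge> K m \<Longrightarrow> j \<ge> K m \<Longrightarrow>
      prob {\<omega> \<in> space M. \<bar>Y i \<omega> - Y j \<omega>\<bar> > (1/2)^m} < (1/2)^m"
    by metis
  \<comment> \<open>The sum makes \<open>r\<close> monotone with \<open>r m \<ge> K m\<close>; the
    summand \<open>m\<close> makes it unbounded.\<close>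
  define r where "r m = m + (\<Sum>l\<le>m. K l)" for m
  have r_ge: "K m \<le> r m" "r m \<le> r (Suc m)" "m \<le> r m" for m
    by (auto simp: r_def intro: trans_le_add2 member_le_sum[of m "{..m}" K])
  define A where "A m = {\<omega> \<in> space M. \<bar>Y (r (Suc m)) \<omega> - Y (r m) \<omega>\<bar> > (1/2)^m}" for m
  have A_meas: "A m \<in> sets M" for m
    unfolding A_def by measurable
  have A_prob: "prob (A m) \<le> (1/2)^m" for m
    unfolding A_def by (rule less_imp_le, rule K) (use r_ge[of m] in auto)
  have "summable (\<lambda>m. prob (A m))"
    by (rule summable_comparison_test[of _ "\<lambda>m. (1/2)^m"]) (use A_prob in \<open>auto simp: summable_geometric\<close>)
  then have "AE \<omega> in M. eventually (\<lambda>m. \<omega> \<in> space M - A m) sequentially"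
    by (intro borel_cantelli_AE1 A_meas) (auto simp: emeasure_eq_measure less_top)
  then have conv: "AE \<omega> in M. convergent (\<lambda>m. Y (r m) \<omega>)"
  proof eventually_elim
    case (elim \<omega>)
    then obtain m0 where m0: "\<And>m. m \<ge> m0 \<Longrightarrow> \<bar>Y (r (Suc m)) \<omega> - Y (r m) \<omega>\<bar> \<le> (1/2)^m"
      by (auto simp: A_def eventually_sequentially not_less)
    have "summable (\<lambda>m. Y (r (Suc m)) \<omega> - Y (r m) \<omega>)"
      by (rule summable_comparison_test[of _ "\<lambda>m. (1/2)^m"]) (use m0 in \<open>auto simp: summable_geometric\<close>)
    then have "convergent (\<lambda>n. \<Sum>m<n. Y (r (Suc m)) \<omega> - Y (r m) \<omega>)"
      by (simp add: summable_iff_convergent)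
    then have "convergent (\<lambda>n. Y (r n) \<omega> - Y (r 0) \<omega>)"
      by (subst (asm) sum_lessThan_telescope)
    then show ?case
      by (simp add: convergent_diff_const_right_iff)
  qed
  \<comment> \<open>Off the convergence set the value of \<open>lim\<close> is arbitrary; that set
    is null.\<close>
  define I where "I \<omega> = lim (\<lambda>m. Y (r m) \<omega>)" for \<omega>
  have I[measurable]: "I \<in> borel_measurable M"
    unfolding I_def[abs_def] by measurable
  have "AE \<omega> in M. (\<lambda>m. Y (r m) \<omega>) \<longlonglongrightarrow> I \<omega>"
    using conv by eventually_elim (simp add: I_def convergent_LIMSEQ_iff)
  then have lim: "(\<lambda>m. prob {\<omega> \<in> space M. \<bar>Y (r m) \<omega> - I \<omega>\<bar> > e}) \<longlonglongrightarrow> 0" if "e > 0" for e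
    using that by (intro AE_tendsto_imp_prob_tendsto_0) auto
  have "\<exists>K. \<forall>i\<ge>K. prob {\<omega> \<in> space M. \<bar>Y i \<omega> - I \<omega>\<bar> > e} < e" if e: "e > 0" for e
  proof -
    obtain K1 where K1: "\<And>i j. i \<ge> K1 \<Longrightarrow> j \<ge> K1 \<Longrightarrow> prob {\<omega> \<in> space M. \<bar>Y i \<omega> - Y j \<omega>\<bar> > e / 2} < e / 2"
      using Cauchy[of "e / 2"] e by auto
    have "eventually (\<lambda>m. prob {\<omega> \<in> space M. \<bar>Y (r m) \<omega> - I \<omega>\<bar> > e / 2} < e / 2) sequentially"
      using lim[of "e / 2"] e by (intro order_tendstoD) auto
    then obtain m where m: "m \<ge> K1" "prob {\<omega> \<in> space M. \<bar>Y (r m) \<omega> - I \<omega>\<bar> > e / 2} < e / 2"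
      unfolding eventually_sequentially by (meson nle_le)
    show ?thesis
    proof (intro exI allI impI)
      fix i assume "i \<ge> K1"
      have "prob {\<omega> \<in> space M. \<bar>Y i \<omega> - I \<omega>\<bar> > e / 2 + e / 2} \<le>
          prob {\<omega> \<in> space M. \<bar>Y i \<omega> - Y (r m) \<omega>\<bar> > e / 2} +
          prob {\<omega> \<in> space M. \<bar>Y (r m) \<omega> - I \<omega>\<bar> > e / 2}"
        by (intro prob_le_add_of_abs_le) auto
      also have "\<dots> < e / 2 + e / 2"
        using m r_ge[of m] \<open>i \<ge> K1\<close> by (intro add_strict_mono K1) auto
      finally show "prob {\<omega> \<in> space M. \<bar>Y i \<omega> - I \<omega>\<bar> > e} < e" by simp
    qed
  qed
  with I show ?thesis by blast
qed

text \<open>The two exponentials differ by at most \<open>\<bar>u\<bar> * e\<close> where the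
  variables are within \<open>e\<close> of each other, and by at most 2 on the remaining event of
  small probability.\<close>

lemma tendsto_char_of_convergent_in_probability:
  fixes Y :: "nat \<Rightarrow> 'a \<Rightarrow> real"
  assumes Y[measurable]: "\<And>k. Y k \<in> borel_measurable M" "I \<in> borel_measurable M"
    and lim: "\<And>e. e > 0 \<Longrightarrow> \<exists>K. \<forall>i\<ge>K. prob {\<omega> \<in> space M. \<bar>Y i \<omega> - I \<omega>\<bar> > e} < e"
  shows "(\<lambda>k. char (distr M borel (Y k)) u) \<longlonglongrightarrow> char (distr M borel I) u"
proof (rule metric_LIMSEQ_I)
  fix \<epsilon> :: real assume \<epsilon>: "\<epsilon> > 0"
  \<comment> \<open>The total coefficient of \<open>e\<close> in the estimate, so that
    \<open>w * e\<close> is half of \<open>\<epsilon>\<close>.\<close>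
  define w where "w = \<bar>u\<bar> + 2"
  have w: "w > 0" by (simp add: w_def add_nonneg_pos)
  define e where "e = \<epsilon> / (2 * w)"
  have e: "e > 0" using \<epsilon> w by (simp add: e_def)
  obtain K where K: "\<And>i. i \<ge> K \<Longrightarrow> prob {\<omega> \<in> space M. \<bar>Y i \<omega> - I \<omega>\<bar> > e} < e"
    using lim[OF e] by auto
  show "\<exists>K. \<forall>k\<ge>K. dist (char (distr M borel (Y k)) u) (char (distr M borel I) u) < \<epsilon>"
  proof (intro exI allI impI)
    fix k assume k: "k \<ge> K"
    let ?B = "{\<omega> \<in> space M. \<bar>Y k \<omega> - I \<omega>\<bar> > e}"
    have int: "integrable M (\<lambda>\<omega>. iexp (u * X \<omega>))" if [measurable]: "X \<in> borel_measurable M" for X :: "'a \<Rightarrow> real"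
      by (intro integrable_const_bound[of _ 1]) auto
    have le: "norm (iexp (u * Y k \<omega>) - iexp (u * I \<omega>)) \<le> \<bar>u\<bar> * e + 2 * indicator ?B \<omega>"
      if "\<omega> \<in> space M" for \<omega>
    proof (cases "\<omega> \<in> ?B")
      case True
      have "norm (iexp (u * Y k \<omega>) - iexp (u * I \<omega>)) \<le> 1 + 1"
        by (intro order_trans[OF norm_triangle_ineq4]) simp
      moreover have "\<bar>u\<bar> * e \<ge> 0" using e by simp
      ultimately show ?thesis using True by simp
    next
      case False
      have "norm (iexp (u * Y k \<omega>) - iexp (u * I \<omega>)) =
          norm (iexp (u * I \<omega>) * (iexp (u * Y k \<omega> - u * I \<omega>) - 1))"
        by (simp add: algebra_simps exp_diff)
      also have "\<dots> = norm (iexp (u * Y k \<omega> - u * I \<omega>) - 1)"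
        by (simp add: norm_mult)
      also have "\<dots> \<le> \<bar>u * Y k \<omega> - u * I \<omega>\<bar>"
        using iexp_approx1[of "u * Y k \<omega> - u * I \<omega>" 0] by simp
      also have "\<dots> = \<bar>u\<bar> * \<bar>Y k \<omega> - I \<omega>\<bar>"
        by (simp add: abs_mult flip: right_diff_distrib)
      also have "\<dots> \<le> \<bar>u\<bar> * e"
        using False that by (intro mult_left_mono) auto
      finally show ?thesis using False by simp
    qed
    have "char (distr M borel (Y k)) u - char (distr M borel I) u =
        (\<integral>\<omega>. iexp (u * Y k \<omega>) - iexp (u * I \<omega>) \<partial>M)"
      by (subst Bochner_Integration.integral_diff[OF int int]) (auto simp: char_def integral_distr)
    then have "dist (char (distr M borel (Y k)) u) (char (distr M borel I) u) =
        norm (\<integral>\<omega>. iexp (u * Y k \<omega>) - iexp (u * I \<omega>) \<partial>M)"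
      by (simp add: dist_norm)
    also have "\<dots> \<le> (\<integral>\<omega>. norm (iexp (u * Y k \<omega>) - iexp (u * I \<omega>)) \<partial>M)"
      by (rule integral_norm_bound)
    also have "\<dots> \<le> (\<integral>\<omega>. \<bar>u\<bar> * e + 2 * indicator ?B \<omega> \<partial>M)"
    proof (rule integral_mono)
      show "integrable M (\<lambda>\<omega>. norm (iexp (u * Y k \<omega>) - iexp (u * I \<omega>)))"
        by (intro integrable_norm Bochner_Integration.integrable_diff int) auto
      show "integrable M (\<lambda>\<omega>. \<bar>u\<bar> * e + 2 * indicator ?B \<omega>)"
        by (intro Bochner_Integration.integrable_add integrable_mult_right) (auto simp: emeasure_eq_measure)
    qed (rule le)
    also have "\<dots> = \<bar>u\<bar> * e + 2 * prob ?B"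
      by (subst Bochner_Integration.integral_add) (auto simp: emeasure_eq_measure prob_space)
    finally have "dist (char (distr M borel (Y k)) u) (char (distr M borel I) u) \<le> \<bar>u\<bar> * e + 2 * prob ?B" .
    also have "\<dots> < \<bar>u\<bar> * e + 2 * e + \<epsilon> / 2"
      using K[OF k] \<epsilon> by simp
    finally have less: "dist (char (distr M borel (Y k)) u) (char (distr M borel I) u) < \<bar>u\<bar> * e + 2 * e + \<epsilon> / 2" .
    have "\<bar>u\<bar> * e + 2 * e + \<epsilon> / 2 = w * e + \<epsilon> / 2"
      by (simp add: w_def distrib_right)
    also have "\<dots> = \<epsilon>"
      using w by (simp add: e_def)
    finally have "\<bar>u\<bar> * e + 2 * e + \<epsilon> / 2 = \<epsilon>" .
    with less show "dist (char (distr M borel (Y k)) u) (char (distr M borel I) u) < \<epsilon>"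
      by simp
  qed
qed

end

section \<open>Stable laws and stochastic integrals\<close>

lemma (in prob_space) char_distr_scale:
  assumes [measurable]: "X \<in> borel_measurable M"
  shows "char (distr M borel (\<lambda>\<omega>. k * X \<omega>)) u = char (distr M borel X) (k * u)"
  by (simp add: char_def integral_distr mult_ac)

lemma char_convolution:
  assumes "real_distribution \<mu>" "real_distribution \<nu>"
  shows "char (\<mu> \<star> \<nu>) u = char \<mu> u * char \<nu> u"
proof -
  interpret \<mu>: real_distribution \<mu> by fact
  interpret \<nu>: real_distribution \<nu> by fact
  interpret pair_prob_space \<mu> \<nu> ..
  have int: "integrable (\<mu> \<Otimes>\<^sub>M \<nu>) (\<lambda>(x, y). iexp (u * (x + y)))"
    by (intro P.integrable_const_bound[of _ 1]) (auto simp: split_beta)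
  have "char (\<mu> \<star> \<nu>) u = (\<integral>z. (\<lambda>(x, y). iexp (u * (x + y))) z \<partial>(\<mu> \<Otimes>\<^sub>M \<nu>))"
    by (simp add: char_def convolution_def integral_distr split_beta)
  also have "\<dots> = (\<integral>x. \<integral>y. iexp (u * (x + y)) \<partial>\<nu> \<partial>\<mu>)"
    using integral_fst'[OF int] by simp
  also have "\<dots> = (\<integral>x. \<integral>y. iexp (u * x) * iexp (u * y) \<partial>\<nu> \<partial>\<mu>)"
    by (simp add: distrib_left exp_add)
  also have "\<dots> = char \<mu> u * char \<nu> u"
    by (simp add: char_def)
  finally show ?thesis .
qed

text \<open>By uniqueness of characteristic functions it suffices that the exponents add:
  \<open>C powr \<alpha> = A powr \<alpha> + B powr \<alpha>\<close>. By symmetry the shift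
  \<open>D\<close> can be taken to be 0.\<close>

lemma stable_distribution_of_char:
  assumes \<mu>: "real_distribution \<mu>" and \<alpha>: "0 < \<alpha>" "\<alpha> \<le> 2" and "\<kappa> > 0"
    and char: "\<And>u. char \<mu> u = complex_of_real (exp (- \<kappa> * \<bar>u\<bar> powr \<alpha>))"
  shows "stable_distribution \<alpha> \<mu>"
proof -
  interpret \<mu>: real_distribution \<mu> by fact
  \<comment> \<open>A point mass has a characteristic function of modulus 1, while the given one is
    \<open>exp (- \<kappa>) < 1\<close> at 1.\<close>
  have "measure \<mu> {c} < 1" for c
  proof (rule ccontr)
    assume "\<not> measure \<mu> {c} < 1"
    then have "measure \<mu> {c} = 1"
      using \<mu>.prob_le_1[of "{c}"] by simp
    then have "AE x in \<mu>. x \<in> {c}"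
      by (subst \<mu>.AE_in_set_eq_1) auto
    then have "char \<mu> 1 = (\<integral>x. iexp c \<partial>\<mu>)"
      unfolding char_def by (intro integral_cong_AE) (auto elim!: eventually_mono)
    then have "norm (char \<mu> 1) = 1"
      using \<mu>.prob_space by simp
    then show False
      using \<open>\<kappa> > 0\<close> by (simp add: char)
  qed
  moreover have "distr \<mu> borel (\<lambda>x. A * x) \<star> distr \<mu> borel (\<lambda>x. B * x) =
      distr \<mu> borel (\<lambda>x. (A powr \<alpha> + B powr \<alpha>) powr (1 / \<alpha>) * x + 0)" if "A > 0" "B > 0" for A B
  proof (rule Levy_uniqueness)
    have [simp]: "real_distribution (distr \<mu> borel (\<lambda>x. c * x))" for c
      by (rule \<mu>.real_distribution_distr) simp
    have char_scale: "char (distr \<mu> borel (\<lambda>x. c * x)) u = complex_of_real (exp (- \<kappa> * c powr \<alpha> * \<bar>u\<bar> powr \<alpha>))"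
      if "c > 0" for c u
      using \<mu>.char_distr_scale[of "\<lambda>x. x" c u] that
      by (simp add: distr_id2 char abs_mult powr_mult)
    interpret A: real_distribution "distr \<mu> borel (\<lambda>x. A * x)" by simp
    interpret B: real_distribution "distr \<mu> borel (\<lambda>x. B * x)" by simp
    interpret pair_prob_space "distr \<mu> borel (\<lambda>x. A * x)" "distr \<mu> borel (\<lambda>x. B * x)" ..
    show "real_distribution (distr \<mu> borel (\<lambda>x. A * x) \<star> distr \<mu> borel (\<lambda>x. B * x))"
      unfolding convolution_def by (rule P.real_distribution_distr) (simp add: split_beta)
    show "real_distribution (distr \<mu> borel (\<lambda>x. (A powr \<alpha> + B powr \<alpha>) powr (1 / \<alpha>) * x + 0))"
      by simp
    have pos: "A powr \<alpha> + B powr \<alpha> > 0"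
      using that by (simp add: add_pos_pos)
    show "char (distr \<mu> borel (\<lambda>x. A * x) \<star> distr \<mu> borel (\<lambda>x. B * x)) =
        char (distr \<mu> borel (\<lambda>x. (A powr \<alpha> + B powr \<alpha>) powr (1 / \<alpha>) * x + 0))"
    proof
      fix u
      define C where "C = (A powr \<alpha> + B powr \<alpha>) powr (1 / \<alpha>)"
      have C: "C > 0" "C powr \<alpha> = A powr \<alpha> + B powr \<alpha>"
        using pos \<alpha> by (simp_all add: C_def powr_powr)
      have "char (distr \<mu> borel (\<lambda>x. A * x) \<star> distr \<mu> borel (\<lambda>x. B * x)) u =
          complex_of_real (exp (- \<kappa> * A powr \<alpha> * \<bar>u\<bar> powr \<alpha>) * exp (- \<kappa> * B powr \<alpha> * \<bar>u\<bar> powr \<alpha>))"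
        using that by (simp add: char_convolution char_scale)
      also have "exp (- \<kappa> * A powr \<alpha> * \<bar>u\<bar> powr \<alpha>) * exp (- \<kappa> * B powr \<alpha> * \<bar>u\<bar> powr \<alpha>) =
          exp (- \<kappa> * C powr \<alpha> * \<bar>u\<bar> powr \<alpha>)"
        unfolding C exp_add[symmetric] by (simp add: algebra_simps)
      also have "complex_of_real \<dots> = char (distr \<mu> borel (\<lambda>x. C * x + 0)) u"
        using char_scale[OF C(1), of u] by simp
      finally show "char (distr \<mu> borel (\<lambda>x. A * x) \<star> distr \<mu> borel (\<lambda>x. B * x)) u =
          char (distr \<mu> borel (\<lambda>x. (A powr \<alpha> + B powr \<alpha>) powr (1 / \<alpha>) * x + 0)) u"
        unfolding C_def .
    qed
  qed
  ultimately show ?thesis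
    using \<mu> \<alpha> unfolding stable_distribution_def by blast
qed

section \<open>Scales of linear combinations of increments\<close>

locale symmetric_stable_levy_process = levy_process M L
  for M :: "'a measure" and L :: "real \<Rightarrow> 'a \<Rightarrow> real" +
  fixes \<alpha> \<sigma> :: real
  assumes \<alpha>_pos: "\<alpha> > 0" and \<sigma>_pos: "\<sigma> > 0"
    and char_L: "\<And>u t. t \<ge> 0 \<Longrightarrow>
      char (distr M borel (L t)) u = complex_of_real (exp (- t * \<sigma> powr \<alpha> * \<bar>u\<bar> powr \<alpha>))"
begin

text \<open>The number \<open>c\<close> is the \<open>\<alpha>\<close>-th power of the scale relative to \<open>L 1\<close>; it is additive over
  independent summands.\<close>

definition has_scale :: "('a \<Rightarrow> real) \<Rightarrow> real \<Rightarrow> bool" where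
  "has_scale X c \<longleftrightarrow> X \<in> borel_measurable M \<and>
    (\<forall>u. char (distr M borel X) u = complex_of_real (exp (- c * (\<sigma> powr \<alpha> * \<bar>u\<bar> powr \<alpha>))))"

lemma has_scale_measurable: "has_scale X c \<Longrightarrow> X \<in> borel_measurable M"
  by (simp add: has_scale_def)

lemma has_scale_char:
  "has_scale X c \<Longrightarrow>
    char (distr M borel X) u = complex_of_real (exp (- c * (\<sigma> powr \<alpha> * \<bar>u\<bar> powr \<alpha>)))"
  by (simp add: has_scale_def)

text \<open>A concrete variable for every scale, with \<open>c = 0\<close> giving the zero variable.
  It serves for comparing tails and as the candidate limit law.\<close>

lemma has_scale_mult_L_1:
  assumes "c \<ge> 0"
  shows "has_scale (\<lambda>\<omega>. c powr (1 / \<alpha>) * L 1 \<omega>) c"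
proof -
  have L1[measurable]: "L 1 \<in> borel_measurable M"
    by (rule random_variable_at) simp
  have "\<bar>c powr (1 / \<alpha>) * u\<bar> powr \<alpha> = c * \<bar>u\<bar> powr \<alpha>" for u
    using assms \<alpha>_pos by (simp add: abs_mult powr_mult powr_powr)
  then show ?thesis
    by (simp add: has_scale_def char_distr_scale char_L)
qed

lemma prob_tail_has_scale:
  assumes X: "has_scale X c" and "c \<ge> 0"
  shows "prob {\<omega> \<in> space M. \<bar>X \<omega>\<bar> > e} = prob {\<omega> \<in> space M. \<bar>c powr (1 / \<alpha>) * L 1 \<omega>\<bar> > e}"
proof -
  define Y where "Y \<omega> = c powr (1 / \<alpha>) * L 1 \<omega>" for \<omega>
  have Y: "has_scale Y c"
    unfolding Y_def by (rule has_scale_mult_L_1) fact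
  have tail: "prob {\<omega> \<in> space M. \<bar>Z \<omega>\<bar> > e} = measure (distr M borel Z) {x. \<bar>x\<bar> > e}"
    if "Z \<in> borel_measurable M" for Z
    using that by (subst measure_distr) (auto intro!: arg_cong[where f = prob])
  have "distr M borel X = distr M borel Y"
  proof (rule Levy_uniqueness)
    show "char (distr M borel X) = char (distr M borel Y)"
      by (rule ext) (simp only: has_scale_char[OF X] has_scale_char[OF Y])
  qed (use X Y in \<open>auto intro: has_scale_measurable\<close>)
  then show ?thesis
    unfolding Y_def[symmetric] tail[OF has_scale_measurable[OF X]] tail[OF has_scale_measurable[OF Y]]
    by simp
qed

text \<open>Uniform in \<open>X\<close>: the tail depends on the scale alone and increases with it,
  and the tails of small multiples of \<open>L 1\<close> tend to 0.\<close>

lemma prob_tail_small_scale: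
  assumes e: "e > 0"
  obtains \<delta> where "\<delta> > 0"
    "\<And>X c. has_scale X c \<Longrightarrow> 0 \<le> c \<Longrightarrow> c \<le> \<delta> \<Longrightarrow> prob {\<omega> \<in> space M. \<bar>X \<omega>\<bar> > e} < e"
proof -
  have L1[measurable]: "L 1 \<in> borel_measurable M"
    by (rule random_variable_at) simp
  have "AE \<omega> in M. (\<lambda>k. L 1 \<omega> / real (Suc k)) \<longlonglongrightarrow> 0"
    by (intro AE_I2 LIMSEQ_Suc[OF lim_const_over_n])
  then have "(\<lambda>k. prob {\<omega> \<in> space M. \<bar>L 1 \<omega> / real (Suc k) - 0\<bar> > e}) \<longlonglongrightarrow> 0"
    using e by (intro AE_tendsto_imp_prob_tendsto_0) auto
  then have "eventually (\<lambda>k. prob {\<omega> \<in> space M. \<bar>L 1 \<omega> / real (Suc k) - 0\<bar> > e} < e) sequentially"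
    using e by (auto dest: order_tendstoD(2))
  then obtain k where k: "prob {\<omega> \<in> space M. \<bar>L 1 \<omega> / real (Suc k)\<bar> > e} < e"
    by (auto simp: eventually_sequentially)
  \<comment> \<open>The scale of \<open>L 1 / real (Suc k)\<close>.\<close>
  define \<delta> where "\<delta> = (1 / real (Suc k)) powr \<alpha>"
  have "prob {\<omega> \<in> space M. \<bar>X \<omega>\<bar> > e} < e" if X: "has_scale X c" "0 \<le> c" "c \<le> \<delta>" for X c
  proof -
    have "c powr (1 / \<alpha>) \<le> \<delta> powr (1 / \<alpha>)"
      using X \<alpha>_pos by (intro powr_mono2) auto
    also have "\<dots> = 1 / real (Suc k)"
      using \<alpha>_pos by (simp add: \<delta>_def powr_powr)
    finally have *: "c powr (1 / \<alpha>) \<le> 1 / real (Suc k)" .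
    have "prob {\<omega> \<in> space M. \<bar>X \<omega>\<bar> > e} = prob {\<omega> \<in> space M. \<bar>c powr (1 / \<alpha>) * L 1 \<omega>\<bar> > e}"
      by (rule prob_tail_has_scale[OF X(1,2)])
    also have "\<dots> \<le> prob {\<omega> \<in> space M. \<bar>L 1 \<omega> / real (Suc k)\<bar> > e}"
    proof (rule finite_measure_mono)
      show "{\<omega> \<in> space M. \<bar>c powr (1 / \<alpha>) * L 1 \<omega>\<bar> > e} \<subseteq> {\<omega> \<in> space M. \<bar>L 1 \<omega> / real (Suc k)\<bar> > e}"
      proof safe
        fix \<omega> assume "\<bar>c powr (1 / \<alpha>) * L 1 \<omega>\<bar> > e"
        moreover have "\<bar>c powr (1 / \<alpha>) * L 1 \<omega>\<bar> \<le> \<bar>L 1 \<omega> / real (Suc k)\<bar>"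
          using mult_right_mono[OF *, of "\<bar>L 1 \<omega>\<bar>"] by (simp add: abs_mult)
        ultimately show "\<bar>L 1 \<omega> / real (Suc k)\<bar> > e" by linarith
      qed
    qed measurable
    also note k
    finally show ?thesis .
  qed
  then show ?thesis
    using that[of \<delta>] by (simp add: \<delta>_def)
qed

lemma has_scale_increment:
  assumes "0 \<le> s" "s \<le> t"
  shows "has_scale (\<lambda>\<omega>. L t \<omega> - L s \<omega>) (t - s)"
proof -
  have [measurable]: "L t \<in> borel_measurable M" "L s \<in> borel_measurable M" "L (t - s) \<in> borel_measurable M"
    "L 0 \<in> borel_measurable M"
    using assms by (auto intro: random_variable_at)
  have "distr M borel (\<lambda>\<omega>. L t \<omega> - L s \<omega>) = distr M borel (\<lambda>\<omega>. L (t - s) \<omega> - L 0 \<omega>)"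
    using stationary_increments[of s "t - s"] assms by simp
  also have "\<dots> = distr M borel (L (t - s))"
    using starts_at_zero by (intro distr_cong_AE) auto
  finally show ?thesis
    using assms by (simp add: has_scale_def char_L mult_ac)
qed

text \<open>Independence makes the characteristic function a product, so scales add; a coefficient
  \<open>c i\<close> multiplies its scale by \<open>\<bar>c i\<bar> powr \<alpha>\<close>.\<close>

lemma has_scale_sum_increments:
  assumes "0 \<le> t 0" "\<And>i. i < N \<Longrightarrow> t i \<le> t (Suc i)"
  shows "has_scale (\<lambda>\<omega>. \<Sum>i<N. c i * (L (t (Suc i)) \<omega> - L (t i) \<omega>))
    (\<Sum>i<N. (t (Suc i) - t i) * \<bar>c i\<bar> powr \<alpha>)"
proof -
  have t_nonneg: "0 \<le> t i" if "i \<le> N" for i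
    using that
  proof (induction i)
    case (Suc i)
    then show ?case using assms(2)[of i] by simp
  qed (use assms in simp)
  have inc: "has_scale (\<lambda>\<omega>. L (t (Suc i)) \<omega> - L (t i) \<omega>) (t (Suc i) - t i)" if "i < N" for i
    using that assms t_nonneg[of i] by (intro has_scale_increment) auto
  have "indep_vars (\<lambda>_. borel) (\<lambda>i \<omega>. L (t (Suc i)) \<omega> - L (t i) \<omega>) {..<N}"
    by (rule independent_increments) (use assms in auto)
  then have indep: "indep_vars (\<lambda>_. borel) (\<lambda>i \<omega>. c i * (L (t (Suc i)) \<omega> - L (t i) \<omega>)) {..<N}"
    by (rule indep_vars_compose2) simp
  have "char (distr M borel (\<lambda>\<omega>. c i * (L (t (Suc i)) \<omega> - L (t i) \<omega>))) u =
      complex_of_real (exp (- ((t (Suc i) - t i) * \<bar>c i\<bar> powr \<alpha>) * (\<sigma> powr \<alpha> * \<bar>u\<bar> powr \<alpha>)))"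
    if "i < N" for i u
  proof -
    define D where "D = t (Suc i) - t i"
    have "char (distr M borel (\<lambda>\<omega>. c i * (L (t (Suc i)) \<omega> - L (t i) \<omega>))) u =
        char (distr M borel (\<lambda>\<omega>. L (t (Suc i)) \<omega> - L (t i) \<omega>)) (c i * u)"
      by (rule char_distr_scale[OF has_scale_measurable[OF inc[OF that]]])
    also have "\<dots> = complex_of_real (exp (- D * (\<sigma> powr \<alpha> * \<bar>c i * u\<bar> powr \<alpha>)))"
      using inc[OF that] unfolding has_scale_def D_def by blast
    finally show ?thesis
      by (simp add: abs_mult powr_mult mult_ac flip: D_def)
  qed
  then have "char (distr M borel (\<lambda>\<omega>. \<Sum>i<N. c i * (L (t (Suc i)) \<omega> - L (t i) \<omega>))) u =
      (\<Prod>i<N. complex_of_real (exp (- ((t (Suc i) - t i) * \<bar>c i\<bar> powr \<alpha>) * (\<sigma> powr \<alpha> * \<bar>u\<bar> powr \<alpha>))))" for u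
    unfolding char_distr_sum[OF indep] by (intro prod.cong) auto
  moreover have "(\<lambda>\<omega>. \<Sum>i<N. c i * (L (t (Suc i)) \<omega> - L (t i) \<omega>)) \<in> borel_measurable M"
    using inc[THEN has_scale_measurable] by (intro borel_measurable_sum borel_measurable_times) auto
  ultimately show ?thesis
    by (simp add: has_scale_def sum_distrib_right exp_sum flip: of_real_prod sum_negf)
qed

text \<open>The condition \<open>s \<le> a\<close> keeps the shifted times \<open>t i - s\<close>
  nonnegative, where \<open>L\<close> is constrained.\<close>

lemma has_scale_riemann_sum:
  assumes t: "partition_below a b d N t" and "s \<le> a"
  shows "has_scale (riemann_sum (\<lambda>r. L (r - s)) f N t) (\<Sum>i<N. \<bar>f (t i)\<bar> powr \<alpha> * (t (Suc i) - t i))"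
  using has_scale_sum_increments[of "\<lambda>i. t i - s" N "\<lambda>i. f (t i)"] assms
  by (simp add: riemann_sum_def[abs_def] partition_below_def mult.commute)

section \<open>Existence and law of the stochastic integral\<close>

text \<open>On a common refinement the difference of two sums is one sum of increments. Both step
  functions are within \<open>\<eta>\<close> of \<open>f\<close>, so its coefficients are at most
  \<open>2 * \<eta>\<close> and its scale is small.\<close>

lemma prob_riemann_sum_diff_small:
  assumes f: "continuous_on {a..b} f" and "s \<le> a" "a \<le> b" and e: "e > 0"
  shows "\<exists>d>0. \<forall>N t N' t'. partition_below a b d N t \<longrightarrow> partition_below a b d N' t' \<longrightarrow>
    prob {\<omega> \<in> space M. \<bar>riemann_sum (\<lambda>r. L (r - s)) f N t \<omega> - riemann_sum (\<lambda>r. L (r - s)) f N' t' \<omega>\<bar> > e} < e"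
proof -
  obtain \<delta> where \<delta>: "\<delta> > 0"
    "\<And>X c. has_scale X c \<Longrightarrow> 0 \<le> c \<Longrightarrow> c \<le> \<delta> \<Longrightarrow> prob {\<omega> \<in> space M. \<bar>X \<omega>\<bar> > e} < e"
    using prob_tail_small_scale[OF e] by metis
  \<comment> \<open>Chosen so that
    \<open>(2 * \<eta>) powr \<alpha> = \<delta> / (b - a + 1)\<close>; the added 1 covers
    \<open>a = b\<close>.\<close>
  define \<eta> where "\<eta> = (\<delta> / (b - a + 1)) powr (1 / \<alpha>) / 2"
  have \<eta>: "\<eta> > 0" "(2 * \<eta>) powr \<alpha> * (b - a) \<le> \<delta>"
    using \<delta> \<alpha>_pos assms by (simp_all add: \<eta>_def powr_powr field_simps)
  obtain d where d: "d > 0"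
    "\<And>x y. x \<in> {a..b} \<Longrightarrow> y \<in> {a..b} \<Longrightarrow> \<bar>x - y\<bar> < d \<Longrightarrow> \<bar>f x - f y\<bar> \<le> \<eta>"
    using uniformly_continuous_modulus[OF f \<eta>(1)] by metis
  show ?thesis
  proof (intro exI conjI allI impI)
    fix N t N' t'
    assume t: "partition_below a b d N t" and t': "partition_below a b d N' t'"
    obtain K :: nat and u :: "nat \<Rightarrow> real" where u: "strict_mono_on {..K} u" "u 0 = a" "u K = b"
      "t ` {..N} \<subseteq> u ` {..K}" "t' ` {..N'} \<subseteq> u ` {..K}"
      by (rule common_refinement[OF t t'])
    define c where "c j = step_fun f N t (u j) - step_fun f N' t' (u j)" for j
    have u_less: "u j < u (Suc j)" if "j < K" for j
      using strict_mono_onD[OF u(1), of j "Suc j"] that by auto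
    have c: "\<bar>c j\<bar> \<le> 2 * \<eta>" if "j < K" for j
    proof -
      have "a \<le> u j" "u j < b"
        using strict_mono_on_leD[OF u(1), of 0 j] strict_mono_onD[OF u(1), of j K] that u by auto
      then show ?thesis
        using step_fun_approx[OF t, of "u j" f, OF _ _ d(2)] step_fun_approx[OF t', of "u j" f, OF _ _ d(2)]
        unfolding c_def by linarith
    qed
    have "has_scale (\<lambda>\<omega>. \<Sum>j<K. c j * (L (u (Suc j) - s) \<omega> - L (u j - s) \<omega>))
        (\<Sum>j<K. (u (Suc j) - u j) * \<bar>c j\<bar> powr \<alpha>)"
      using has_scale_sum_increments[of "\<lambda>i. u i - s" K c] u(2) \<open>s \<le> a\<close> u_less by force
    also have "(\<lambda>\<omega>. \<Sum>j<K. c j * (L (u (Suc j) - s) \<omega> - L (u j - s) \<omega>)) =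
        (\<lambda>\<omega>. riemann_sum (\<lambda>r. L (r - s)) f N t \<omega> - riemann_sum (\<lambda>r. L (r - s)) f N' t' \<omega>)"
      by (simp add: riemann_sum_refine[OF t u(1,4)] riemann_sum_refine[OF t' u(1,5)] c_def
          left_diff_distrib sum_subtractf)
    finally have scale: "has_scale (\<lambda>\<omega>. riemann_sum (\<lambda>r. L (r - s)) f N t \<omega>
        - riemann_sum (\<lambda>r. L (r - s)) f N' t' \<omega>) (\<Sum>j<K. (u (Suc j) - u j) * \<bar>c j\<bar> powr \<alpha>)" .
    have nonneg: "(\<Sum>j<K. (u (Suc j) - u j) * \<bar>c j\<bar> powr \<alpha>) \<ge> 0"
      using u_less by (intro sum_nonneg mult_nonneg_nonneg) (auto simp: less_imp_le)
    have le: "(\<Sum>j<K. (u (Suc j) - u j) * \<bar>c j\<bar> powr \<alpha>) \<le> \<delta>"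
    proof -
      have "(\<Sum>j<K. (u (Suc j) - u j) * \<bar>c j\<bar> powr \<alpha>) \<le> (\<Sum>j<K. (u (Suc j) - u j) * (2 * \<eta>) powr \<alpha>)"
        using c u_less \<alpha>_pos by (intro sum_mono mult_left_mono powr_mono2) (auto simp: less_imp_le)
      also have "\<dots> = (2 * \<eta>) powr \<alpha> * (b - a)"
        by (simp add: sum_lessThan_telescope u mult.commute flip: sum_distrib_right)
      finally show ?thesis using \<eta> by simp
    qed
    show "prob {\<omega> \<in> space M.
        \<bar>riemann_sum (\<lambda>r. L (r - s)) f N t \<omega> - riemann_sum (\<lambda>r. L (r - s)) f N' t' \<omega>\<bar> > e} < e"
      by (rule \<delta>(2)[OF scale nonneg le])
  qed (rule d(1))
qed

text \<open>The sums over uniform partitions are Cauchy in probability and define \<open>I\<close>;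
  any other fine partition is compared with a fine uniform one.\<close>

lemma ex_has_stochastic_integral:
  assumes f: "continuous_on {a..b} f" and ab: "s \<le> a" "a \<le> b"
  shows "\<exists>I. has_stochastic_integral M (\<lambda>r. L (r - s)) f a b I"
proof -
  let ?S = "riemann_sum (\<lambda>r. L (r - s)) f"
  define Y where "Y k = ?S (Suc k) (uniform_partition a b k)" for k
  have S_meas: "?S N t \<in> borel_measurable M" if "partition_below a b d N t" for d N t
    using has_scale_measurable has_scale_riemann_sum[OF that ab(1)] by blast
  have Y_meas: "Y k \<in> borel_measurable M" for k
    unfolding Y_def by (rule S_meas, rule partition_below_uniform[OF ab(2) less_add_one])
  note cauchy = prob_riemann_sum_diff_small[OF f ab]
  have Y_part: "\<exists>K. \<forall>i\<ge>K. partition_below a b d (Suc i) (uniform_partition a b i)" if "d > 0" for d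
    using eventually_partition_below_uniform[OF ab(2) that] by (simp add: eventually_sequentially)
  have cauchy_Y: "\<exists>K. \<forall>i\<ge>K. \<forall>j\<ge>K. prob {\<omega> \<in> space M. \<bar>Y i \<omega> - Y j \<omega>\<bar> > e} < e" if e: "e > 0" for e
  proof -
    obtain d where d: "d > 0" "\<And>N t N' t'. partition_below a b d N t \<Longrightarrow> partition_below a b d N' t' \<Longrightarrow>
        prob {\<omega> \<in> space M. \<bar>?S N t \<omega> - ?S N' t' \<omega>\<bar> > e} < e"
      using cauchy[OF e] by auto
    obtain K where K: "\<And>i. i \<ge> K \<Longrightarrow> partition_below a b d (Suc i) (uniform_partition a b i)"
      using Y_part[OF d(1)] by auto
    show ?thesis
      unfolding Y_def using d(2)[OF K K] by blast
  qed
  obtain I where I: "I \<in> borel_measurable M"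
    "\<And>e. e > 0 \<Longrightarrow> \<exists>K. \<forall>i\<ge>K. prob {\<omega> \<in> space M. \<bar>Y i \<omega> - I \<omega>\<bar> > e} < e"
    using Cauchy_in_probability_imp_convergent[of Y, OF Y_meas cauchy_Y] by auto
  have "\<exists>d>0. \<forall>N t. partition_below a b d N t \<longrightarrow> prob {\<omega> \<in> space M. \<bar>?S N t \<omega> - I \<omega>\<bar> > e} < e"
    if e: "e > 0" for e
  proof -
    obtain d where d: "d > 0" "\<And>N t N' t'. partition_below a b d N t \<Longrightarrow> partition_below a b d N' t' \<Longrightarrow>
        prob {\<omega> \<in> space M. \<bar>?S N t \<omega> - ?S N' t' \<omega>\<bar> > e / 2} < e / 2"
      using cauchy[of "e / 2"] e by auto
    obtain K where K: "\<And>i. i \<ge> K \<Longrightarrow> partition_below a b d (Suc i) (uniform_partition a b i)"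
      using Y_part[OF d(1)] by auto
    obtain K' where K': "\<And>i. i \<ge> K' \<Longrightarrow> prob {\<omega> \<in> space M. \<bar>Y i \<omega> - I \<omega>\<bar> > e / 2} < e / 2"
      using I(2)[of "e / 2"] e by auto
    define k where "k = max K K'"
    show ?thesis
    proof (intro exI conjI allI impI)
      fix N t assume t: "partition_below a b d N t"
      have "prob {\<omega> \<in> space M. \<bar>?S N t \<omega> - I \<omega>\<bar> > e / 2 + e / 2} \<le>
          prob {\<omega> \<in> space M. \<bar>?S N t \<omega> - Y k \<omega>\<bar> > e / 2} + prob {\<omega> \<in> space M. \<bar>Y k \<omega> - I \<omega>\<bar> > e / 2}"
        using S_meas[OF t] Y_meas I(1)
        by (intro prob_le_add_of_abs_le borel_measurable_diff) auto
      also have "\<dots> < e / 2 + e / 2"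
        unfolding Y_def[of k, symmetric]
        using d(2)[OF t K[of k]] K'[of k] by (intro add_strict_mono) (auto simp: k_def Y_def)
      finally show "prob {\<omega> \<in> space M. \<bar>?S N t \<omega> - I \<omega>\<bar> > e} < e" by simp
    qed (rule d(1))
  qed
  then show ?thesis
    unfolding has_stochastic_integral_iff using I(1) by blast
qed

text \<open>Along uniform partitions the scales are themselves Riemann sums of
  \<open>\<bar>f\<bar> powr \<alpha>\<close>, and characteristic functions pass to the
  limit.\<close>

lemma has_scale_has_stochastic_integral:
  assumes f: "continuous_on {a..b} f" and ab: "s \<le> a" "a \<le> b"
    and I: "has_stochastic_integral M (\<lambda>r. L (r - s)) f a b I"
  shows "has_scale I (integral {a..b} (\<lambda>r. \<bar>f r\<bar> powr \<alpha>))"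
proof -
  let ?S = "riemann_sum (\<lambda>r. L (r - s)) f"
  let ?g = "\<lambda>r. \<bar>f r\<bar> powr \<alpha>"
  define t where "t k = uniform_partition a b k" for k
  define Y where "Y k = ?S (Suc k) (t k)" for k
  define c where "c k = (\<Sum>i<Suc k. ?g (t k i) * (t k (Suc i) - t k i))" for k
  have I_meas: "I \<in> borel_measurable M"
    using I by (simp add: has_stochastic_integral_def)
  have Y: "has_scale (Y k) (c k)" for k
    unfolding Y_def c_def t_def
    by (rule has_scale_riemann_sum[OF partition_below_uniform[OF ab(2) less_add_one] ab(1)])
  have Y_part: "\<exists>K. \<forall>i\<ge>K. partition_below a b d (Suc i) (t i)" if "d > 0" for d
    using eventually_partition_below_uniform[OF ab(2) that] by (simp add: eventually_sequentially t_def)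
  have g: "continuous_on {a..b} ?g"
    using f \<alpha>_pos by (intro continuous_on_powr' continuous_intros) auto
  have "\<exists>K. \<forall>i\<ge>K. prob {\<omega> \<in> space M. \<bar>Y i \<omega> - I \<omega>\<bar> > e} < e" if e: "e > 0" for e
  proof -
    obtain d where "d > 0" and
      d: "\<And>N t. partition_below a b d N t \<Longrightarrow> prob {\<omega> \<in> space M. \<bar>?S N t \<omega> - I \<omega>\<bar> > e} < e"
      using I e unfolding has_stochastic_integral_iff by auto
    obtain K where "\<And>i. i \<ge> K \<Longrightarrow> partition_below a b d (Suc i) (t i)"
      using Y_part[OF \<open>d > 0\<close>] by auto
    then show ?thesis
      unfolding Y_def using d by auto
  qed
  then have "(\<lambda>k. char (distr M borel (Y k)) u) \<longlonglongrightarrow> char (distr M borel I) u" for u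
    using I_meas has_scale_measurable[OF Y] by (intro tendsto_char_of_convergent_in_probability) auto
  moreover have "c \<longlonglongrightarrow> integral {a..b} ?g"
  proof (rule metric_LIMSEQ_I)
    fix \<epsilon> :: real assume "\<epsilon> > 0"
    define e where "e = \<epsilon> / (b - a + 1)"
    have e: "e > 0" "e * (b - a) < \<epsilon>"
      using \<open>\<epsilon> > 0\<close> ab by (auto simp: e_def field_simps)
    obtain d where d: "d > 0"
      "\<And>x y. x \<in> {a..b} \<Longrightarrow> y \<in> {a..b} \<Longrightarrow> \<bar>x - y\<bar> < d \<Longrightarrow> \<bar>?g x - ?g y\<bar> \<le> e"
      using uniformly_continuous_modulus[OF g e(1)] by metis
    obtain K where K: "\<And>i. i \<ge> K \<Longrightarrow> partition_below a b d (Suc i) (t i)"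
      using Y_part[OF d(1)] by auto
    show "\<exists>K. \<forall>k\<ge>K. dist (c k) (integral {a..b} ?g) < \<epsilon>"
    proof (intro exI allI impI)
      fix k assume "k \<ge> K"
      from riemann_sum_error[OF K[OF this] g d(2)] e(2)
      show "dist (c k) (integral {a..b} ?g) < \<epsilon>"
        by (simp add: dist_real_def c_def abs_minus_commute del: sum.lessThan_Suc)
    qed
  qed
  then have "(\<lambda>k. complex_of_real (exp (- c k * (\<sigma> powr \<alpha> * \<bar>u\<bar> powr \<alpha>)))) \<longlonglongrightarrow>
      complex_of_real (exp (- integral {a..b} ?g * (\<sigma> powr \<alpha> * \<bar>u\<bar> powr \<alpha>)))" for u
    by (intro tendsto_intros)
  ultimately have "char (distr M borel I) u =
      complex_of_real (exp (- integral {a..b} ?g * (\<sigma> powr \<alpha> * \<bar>u\<bar> powr \<alpha>)))" for u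
    using Y LIMSEQ_unique unfolding has_scale_def by fastforce
  then show ?thesis
    using I_meas by (simp add: has_scale_def)
qed

text \<open>Existence turns the choice operator in \<open>stochastic_integral\<close> into an actual
  integral; the reflection \<open>r \<mapsto> - r\<close> moves the domain to
  \<open>{0..- s}\<close>.\<close>

lemma has_scale_component:
  assumes n: "n \<ge> 1" and s: "s \<le> 0"
  shows "has_scale (component M L n \<nu> s) (integral {0..- s} (\<lambda>r. \<bar>H n \<nu> r\<bar> powr \<alpha>))"
proof -
  let ?f = "\<lambda>r. H n \<nu> (- r)"
  have f: "continuous_on {s..0} ?f"
    by (rule continuous_on_compose2[OF continuous_on_H[OF n, of UNIV]]) (auto intro: continuous_intros)
  have "has_stochastic_integral M (\<lambda>r. L (r - s)) ?f s 0 (component M L n \<nu> s)"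
    unfolding component_def stochastic_integral_def
    using ex_has_stochastic_integral[OF f order_refl s] by (rule someI_ex)
  from has_scale_has_stochastic_integral[OF f order_refl s this] show ?thesis
    using Henstock_Kurzweil_Integration.integral_reflect_real[where a = 0 and b = "- s"
        and f = "\<lambda>r. \<bar>H n \<nu> r\<bar> powr \<alpha>"] by simp
qed

section \<open>Integrability of the kernel power as the criterion for a limit law\<close>

lemma stationary_distribution_exists_of_integrable:
  assumes n: "n \<ge> 1" and int: "set_integrable lborel {0<..} (\<lambda>r. \<bar>H n \<nu> r\<bar> powr \<alpha>)"
  shows "stationary_distribution_exists M L n \<nu>"
proof -
  let ?f = "\<lambda>r. \<bar>H n \<nu> r\<bar> powr \<alpha>"
  define A where "A = (LINT r:{0<..}|lborel. ?f r)"
  have A: "A \<ge> 0"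
    unfolding A_def set_lebesgue_integral_def by (intro integral_nonneg_AE) auto
  have lim: "((\<lambda>T. integral {0..T} ?f) \<longlongrightarrow> A) at_top"
    unfolding A_def using n \<alpha>_pos int by (intro tendsto_integral_atLeast_0 continuous_on_abs_H_powr)
  define \<mu> where "\<mu> = distr M borel (\<lambda>\<omega>. A powr (1 / \<alpha>) * L 1 \<omega>)"
  note \<mu> = has_scale_mult_L_1[OF A]
  have real: "real_distribution \<mu>"
    unfolding \<mu>_def by (intro real_distribution_distr has_scale_measurable[OF \<mu>])
  have "((\<lambda>s. cdf (distr M borel (component M L n \<nu> s)) x) \<longlongrightarrow> cdf \<mu> x) at_bot"
    if x: "isCont (cdf \<mu>) x" for x
  \<comment> \<open>Levy's continuity theorem speaks of sequences, so the limit at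
    \<open>at_bot\<close> is tested along an arbitrary sequence \<open>S\<close>.\<close>
  proof (rule tendsto_at_botI_sequentially)
    fix S :: "nat \<Rightarrow> real" assume S: "filterlim S at_bot sequentially"
    \<comment> \<open>Truncation makes the scale formula, valid for times at most 0, available for
      every \<open>k\<close>; eventually nothing is changed.\<close>
    define S' where "S' k = min (S k) 0" for k
    have ev: "eventually (\<lambda>k. S' k = S k) sequentially"
      using S by (auto simp: S'_def filterlim_at_bot elim!: allE[of _ 0] eventually_mono)
    have "filterlim S' at_bot sequentially"
      using S by (rule filterlim_cong[THEN iffD1, rotated -1]) (use ev in \<open>auto elim: eventually_mono\<close>)
    then have S': "filterlim (\<lambda>k. - S' k) at_top sequentially"
      by (simp add: filterlim_uminus_at_top)
    have scale: "has_scale (component M L n \<nu> (S' k)) (integral {0..- S' k} ?f)" for k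
      by (intro has_scale_component n) (simp add: S'_def)
    have "weak_conv_m (\<lambda>k. distr M borel (component M L n \<nu> (S' k))) \<mu>"
    proof (rule levy_continuity)
      show "real_distribution (distr M borel (component M L n \<nu> (S' k)))" for k
        by (intro real_distribution_distr has_scale_measurable[OF scale])
      show "(\<lambda>k. char (distr M borel (component M L n \<nu> (S' k))) u) \<longlonglongrightarrow> char \<mu> u" for u
        unfolding \<mu>_def has_scale_char[OF scale] has_scale_char[OF \<mu>]
        by (intro tendsto_intros filterlim_compose[OF lim S'])
    qed (rule real)
    then have "(\<lambda>k. cdf (distr M borel (component M L n \<nu> (S' k))) x) \<longlonglongrightarrow> cdf \<mu> x"
      using x by (simp add: weak_conv_m_def weak_conv_def)
    moreover have "eventually (\<lambda>k. cdf (distr M borel (component M L n \<nu> (S' k))) x =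
        cdf (distr M borel (component M L n \<nu> (S k))) x) sequentially"
      using ev by eventually_elim simp
    ultimately show "(\<lambda>k. cdf (distr M borel (component M L n \<nu> (S k))) x) \<longlonglongrightarrow> cdf \<mu> x"
      by (rule Lim_transform_eventually)
  qed
  then show ?thesis
    unfolding stationary_distribution_exists_def is_stationary_distribution_def
      converges_in_distribution_def using real by blast
qed

text \<open>The converse: if the scales \<open>A k\<close> were unbounded, the limiting
  characteristic function would vanish away from 0, against its continuity at 0.\<close>

lemma is_stationary_distributionD:
  assumes n: "n \<ge> 1" and \<mu>: "is_stationary_distribution M L n \<nu> \<mu>"
  shows "set_integrable lborel {0<..} (\<lambda>r. \<bar>H n \<nu> r\<bar> powr \<alpha>)"
    and "char \<mu> u = complex_of_real (exp (- (LINT r:{0<..}|lborel. \<bar>H n \<nu> r\<bar> powr \<alpha>)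
      * (\<sigma> powr \<alpha> * \<bar>u\<bar> powr \<alpha>)))"
proof -
  let ?f = "\<lambda>r. \<bar>H n \<nu> r\<bar> powr \<alpha>"
  have cont: "continuous_on S ?f" for S
    using n \<alpha>_pos by (intro continuous_on_abs_H_powr)
  define A where "A k = integral {0..real k} ?f" for k
  interpret \<mu>: real_distribution \<mu>
    using \<mu> by (simp add: is_stationary_distribution_def converges_in_distribution_def)
  have scale: "has_scale (component M L n \<nu> (- real k)) (A k)" for k
    using has_scale_component[OF n, of "- real k"] by (simp add: A_def)
  have at_bot: "filterlim (\<lambda>k. - real k) at_bot sequentially"
    by (simp add: filterlim_uminus_at_bot filterlim_real_sequentially)
  have "weak_conv_m (\<lambda>k. distr M borel (component M L n \<nu> (- real k))) \<mu>"
    using \<mu> filterlim_compose[OF _ at_bot]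
    unfolding is_stationary_distribution_def converges_in_distribution_def weak_conv_m_def weak_conv_def
    by blast
  then have "(\<lambda>k. char (distr M borel (component M L n \<nu> (- real k))) v) \<longlonglongrightarrow> char \<mu> v" for v
    by (intro levy_continuity1 real_distribution_distr has_scale_measurable[OF scale] \<mu>.real_distribution_axioms)
  then have lim: "(\<lambda>k. complex_of_real (exp (- A k * (\<sigma> powr \<alpha> * \<bar>v\<bar> powr \<alpha>)))) \<longlonglongrightarrow> char \<mu> v" for v
    by (simp only: has_scale_char[OF scale])
  \<comment> \<open>Continuity at 0 supplies a nonzero \<open>v\<close> at which the modulus exceeds
    1/2; \<open>v \<noteq> 0\<close> makes \<open>\<kappa>\<close> positive, so that a bound on
    \<open>A k\<close> can be read off.\<close>
  have "(char \<mu> \<longlongrightarrow> 1) (at 0)"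
    using \<mu>.isCont_char[of 0] by (simp add: isCont_def \<mu>.char_zero)
  then have "((\<lambda>v. norm (char \<mu> v)) \<longlongrightarrow> norm (1::complex)) (at 0)"
    by (rule tendsto_norm)
  then have "eventually (\<lambda>v. norm (char \<mu> v) > 1 / 2) (at 0)"
    by (rule order_tendstoD) simp
  then have "eventually (\<lambda>v. norm (char \<mu> v) > 1 / 2 \<and> v \<noteq> 0) (at 0)"
    by (auto simp: eventually_at_filter elim: eventually_mono)
  then obtain v where v: "norm (char \<mu> v) > 1 / 2" "v \<noteq> 0"
    using eventually_happens[of _ "at (0::real)"] by auto
  define \<kappa> where "\<kappa> = \<sigma> powr \<alpha> * \<bar>v\<bar> powr \<alpha>"
  have \<kappa>: "\<kappa> > 0"
    using v \<sigma>_pos by (simp add: \<kappa>_def)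
  have "(\<lambda>k. exp (- A k * \<kappa>)) \<longlonglongrightarrow> norm (char \<mu> v)"
    using tendsto_norm[OF lim[of v]] by (simp add: \<kappa>_def)
  then have "eventually (\<lambda>k. exp (- A k * \<kappa>) > 1 / 2) sequentially"
    using v(1) by (rule order_tendstoD(1))
  then obtain K where K: "\<And>k. k \<ge> K \<Longrightarrow> exp (- A k * \<kappa>) > 1 / 2"
    by (auto simp: eventually_sequentially)
  have "A k \<le> ln 2 / \<kappa>" for k
  proof -
    \<comment> \<open>The bound is known only from \<open>K\<close> on; monotonicity of
      \<open>A\<close> extends it to every \<open>k\<close>.\<close>
    have "ln (1 / 2) < ln (exp (- A (max k K) * \<kappa>))"
      using K[of "max k K"] by (subst ln_less_cancel_iff) auto
    then have "A (max k K) \<le> ln 2 / \<kappa>"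
      using \<kappa> by (simp add: ln_div field_simps)
    moreover have "A k \<le> A (max k K)"
      unfolding A_def by (intro integral_subset_le integrable_continuous_interval cont) auto
    ultimately show ?thesis by simp
  qed
  then show int: "set_integrable lborel {0<..} ?f"
    by (intro set_integrable_atLeast_0I[OF cont]) (auto simp: A_def)
  have "A \<longlonglongrightarrow> (LINT r:{0<..}|lborel. ?f r)"
    unfolding A_def[abs_def]
    by (rule filterlim_compose[OF tendsto_integral_atLeast_0[OF cont int] filterlim_real_sequentially])
  then have "(\<lambda>k. complex_of_real (exp (- A k * (\<sigma> powr \<alpha> * \<bar>u\<bar> powr \<alpha>)))) \<longlonglongrightarrow>
      complex_of_real (exp (- (LINT r:{0<..}|lborel. ?f r) * (\<sigma> powr \<alpha> * \<bar>u\<bar> powr \<alpha>)))"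
    by (intro tendsto_intros)
  then show "char \<mu> u = complex_of_real (exp (- (LINT r:{0<..}|lborel. ?f r) * (\<sigma> powr \<alpha> * \<bar>u\<bar> powr \<alpha>)))"
    using lim LIMSEQ_unique by blast
qed

end

section \<open>Stationary distributions\<close>

lemma bessel_integrand_eq:
  assumes "n \<ge> 1"
  shows "set_integrable lborel {0<..} (\<lambda>r. \<bar>bessel_J n (2 * r)\<bar> powr \<alpha> / r powr \<alpha> * exp (- \<alpha> * \<nu> * r)) \<longleftrightarrow>
      set_integrable lborel {0<..} (\<lambda>r. \<bar>H n \<nu> r\<bar> powr \<alpha>)"
    and "(LINT r:{0<..}|lborel. \<bar>H n \<nu> r\<bar> powr \<alpha>) = real n powr \<alpha> *
      (LINT r:{0<..}|lborel. \<bar>bessel_J n (2 * r)\<bar> powr \<alpha> / r powr \<alpha> * exp (- \<alpha> * \<nu> * r))"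
proof -
  let ?g = "\<lambda>r. \<bar>bessel_J n (2 * r)\<bar> powr \<alpha> / r powr \<alpha> * exp (- \<alpha> * \<nu> * r)"
  have eq: "indicator {0<..} r *\<^sub>R (\<bar>H n \<nu> r\<bar> powr \<alpha>) = real n powr \<alpha> * (indicator {0<..} r *\<^sub>R ?g r)" for r
    \<comment> \<open>For \<open>r \<le> 0\<close> the indicator makes both sides 0.\<close>
    by (cases "r > 0") (simp_all only: abs_H_powr, simp_all)
  have "real n powr \<alpha> \<noteq> 0"
    using assms by simp
  then show "set_integrable lborel {0<..} ?g \<longleftrightarrow> set_integrable lborel {0<..} (\<lambda>r. \<bar>H n \<nu> r\<bar> powr \<alpha>)"
    unfolding set_integrable_def eq integrable_mult_left_iff by blast
  show "(LINT r:{0<..}|lborel. \<bar>H n \<nu> r\<bar> powr \<alpha>) = real n powr \<alpha> * (LINT r:{0<..}|lborel. ?g r)"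
    unfolding set_lebesgue_integral_def eq by (rule integral_mult_right_zero)
qed

theorem mainTheorem3:
  fixes M :: "'a measure" and L :: "real \<Rightarrow> 'a \<Rightarrow> real" and \<alpha> \<sigma> \<nu> :: real
  assumes "\<alpha> \<in> {0<..<2}" and "\<sigma> > 0" and "\<nu> \<ge> 0"
    and "levy_process M L"
    and "\<And>u t. t \<ge> 0 \<Longrightarrow>
      char (distr M borel (L t)) u = complex_of_real (exp (- t * \<sigma> powr \<alpha> * \<bar>u\<bar> powr \<alpha>))"
  shows "(\<nu> > 0 \<longrightarrow> (\<forall>n\<ge>1. stationary_distribution_exists M L n \<nu>))
    \<and> (\<nu> = 0 \<longrightarrow> (\<forall>n\<ge>1. stationary_distribution_exists M L n \<nu> \<longleftrightarrow> \<alpha> \<in> {2/3<..<2}))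
    \<and> (\<forall>n\<ge>1. \<forall>\<mu>. is_stationary_distribution M L n \<nu> \<mu> \<longrightarrow>
         stable_distribution \<alpha> \<mu>
         \<and> set_integrable lborel {0<..}
              (\<lambda>r. \<bar>bessel_J n (2 * r)\<bar> powr \<alpha> / r powr \<alpha> * exp (- \<alpha> * \<nu> * r))
         \<and> (\<forall>u. char \<mu> u = complex_of_real (exp (- (\<bar>u\<bar> powr \<alpha> * \<sigma> powr \<alpha> * real n powr \<alpha> *
              (LINT r:{0<..}|lborel.
                 \<bar>bessel_J n (2 * r)\<bar> powr \<alpha> / r powr \<alpha> * exp (- \<alpha> * \<nu> * r)))))))"
proof -
  have \<alpha>: "0 < \<alpha>" "\<alpha> < 2" using assms(1) by auto
  interpret levy_process M L by fact
  interpret symmetric_stable_levy_process M L \<alpha> \<sigma>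
    by unfold_locales (use \<alpha> assms(2,5) in auto)
  let ?g = "\<lambda>n r. \<bar>bessel_J n (2 * r)\<bar> powr \<alpha> / r powr \<alpha> * exp (- \<alpha> * \<nu> * r)"
  \<comment> \<open>Covers part (i) and the sufficiency in part (ii).\<close>
  have exists: "stationary_distribution_exists M L n \<nu>" if "n \<ge> 1" "\<nu> > 0 \<or> \<nu> = 0 \<and> \<alpha> > 2 / 3" for n
    using that \<alpha> by (intro stationary_distribution_exists_of_integrable set_integrable_abs_H_powr)
  \<comment> \<open>The necessity in part (ii): a limit law forces integrability, which the
    logarithmic divergence excludes for \<open>\<alpha> \<le> 2 / 3\<close>.\<close>
  moreover have "\<alpha> > 2 / 3" if "n \<ge> 1" "\<nu> = 0" "stationary_distribution_exists M L n \<nu>" for n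
  proof (rule ccontr)
    assume "\<not> \<alpha> > 2 / 3"
    moreover have "set_integrable lborel {0<..} (\<lambda>r. \<bar>H n \<nu> r\<bar> powr \<alpha>)"
      using that is_stationary_distributionD(1) unfolding stationary_distribution_exists_def by blast
    ultimately show False
      using not_set_integrable_abs_H_0_powr[of n \<alpha>] that \<alpha> by simp
  qed
  moreover have "stable_distribution \<alpha> \<mu> \<and> set_integrable lborel {0<..} (?g n) \<and>
      (\<forall>u. char \<mu> u = complex_of_real (exp (- (\<bar>u\<bar> powr \<alpha> * \<sigma> powr \<alpha> * real n powr \<alpha> *
        (LINT r:{0<..}|lborel. ?g n r)))))"
    if n: "n \<ge> 1" and \<mu>: "is_stationary_distribution M L n \<nu> \<mu>" for n \<mu>
  proof -
    note int = is_stationary_distributionD(1)[OF n \<mu>]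
    define A where "A = (LINT r:{0<..}|lborel. \<bar>H n \<nu> r\<bar> powr \<alpha>)"
    have char: "char \<mu> u = complex_of_real (exp (- A * (\<sigma> powr \<alpha> * \<bar>u\<bar> powr \<alpha>)))" for u
      unfolding A_def by (rule is_stationary_distributionD(2)[OF n \<mu>])
    have "A > 0"
      unfolding A_def by (rule integral_abs_H_powr_pos[OF n int])
    have "stable_distribution \<alpha> \<mu>"
    proof (rule stable_distribution_of_char)
      show "real_distribution \<mu>"
        using \<mu> by (simp add: is_stationary_distribution_def converges_in_distribution_def)
      show "A * \<sigma> powr \<alpha> > 0"
        using \<open>A > 0\<close> assms(2) by simp
      show "char \<mu> u = complex_of_real (exp (- (A * \<sigma> powr \<alpha>) * \<bar>u\<bar> powr \<alpha>))" for u
        by (simp add: char mult.assoc)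
    qed (use \<alpha> in auto)
    moreover have "set_integrable lborel {0<..} (?g n)"
      using int bessel_integrand_eq(1)[OF n] by simp
    moreover have "- A * (\<sigma> powr \<alpha> * \<bar>u\<bar> powr \<alpha>) = - (\<bar>u\<bar> powr \<alpha> * \<sigma> powr \<alpha> * real n powr \<alpha> *
        (LINT r:{0<..}|lborel. ?g n r))" for u
      unfolding A_def bessel_integrand_eq(2)[OF n] by (simp only: mult_minus_left mult_ac)
    ultimately show ?thesis
      by (simp only: char simp_thms)
  qed
  ultimately show ?thesis
    using assms(3) \<alpha> by auto
qed

end
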